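(* Let $X(z)=X(z,Z)$ be the $\operatorname{Aut}^*(\widehat{\mathfrak{g}})$-valued function described in the context and let $\mathcal{A}=-(\partial_zX)X^{-1}$. For $i=1,\dots,m$ we have $$\mathcal{A}(e_{\gamma_i})=-\sum_{\alpha\in\Gamma_{>0}}[{\bf s}^\alpha]\left(\det\big(\delta_{pq}+s_p\partial_q\Phi_p({\bf s})\big)\,s_i\exp\Big(-\sum_j\alpha_j\Phi_j({\bf s})\Big)\right)\;X(e_\alpha)\Big(\partial_zL(z,Z)(\alpha)-\Big\langle\alpha,\sum_TW_T(Z)\,\partial_zG_T(z,Z)\Big\rangle\Big).$$
   Context: Algebras. $\Gamma$ is a lattice of rank $m$ with an integral skew-symmetric form $\langle-,-\rangle$. $\mathfrak{g}$ has basis $e_\gamma$ ($\gamma\in\Gamma$), bracket $[e_\gamma,e_\eta]=\langle\gamma,\eta\rangle e_{\gamma+\eta}$ and commutative product $e_\gamma e_\eta=e_{\gamma+\eta}$. Fix a strictly convex cone $\Gamma_{\ge0}\subset\Gamma$, $\Gamma_{>0}=\Gamma_{\ge0}\setminus\{0\}$; $\widehat{\mathfrak{g}}=\varprojlim\mathfrak{g}_{\ge0}/\mathfrak{g}_{>k}$, where $\mathfrak{g}_{\ge0}$ is spanned by $e_\gamma$, $\gamma\in\Gamma_{\ge0}$, and $\mathfrak{g}_{>k}$ is given by the cone generated by sums of more than $k$ nonzero elements of $\Gamma_{\ge0}$. $\operatorname{Aut}^*(\widehat{\mathfrak{g}})$: automorphisms for the commutative product. Fix a basis $\gamma_1,\dots,\gamma_m$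 of $\Gamma$ (in $\Gamma_{\ge0}$, such that elements of $\Gamma_{>0}$ have nonnegative coordinates $\alpha=(\alpha_1,\dots,\alpha_m)$). Stability data. Positive generic stability data $(Z,a)$: $Z\in\operatorname{Hom}(\Gamma,\mathbb{C})$, $a(\gamma)=-\mathrm{DT}(\gamma)e_\gamma$, $\mathrm{DT}(\gamma)\in\mathbb{Q}$, $a(\gamma)\ne0\Rightarrow\gamma\in\Gamma_{\ge0}$, support property $\|\gamma\|\le C|Z(\gamma)|$ if $a(\gamma)\ne0$, and if $a(\gamma),a(\eta)\ne0$ with $\ell_\gamma=\ell_\eta$ then $\langle\gamma,\eta\rangle=0$, where $\ell_\gamma=-\mathbb{R}_{>0}Z(\gamma)$. The function $X$. $L(z,Z)=z^{-1}Z+z\bar Z\in\operatorname{Hom}(\Gamma,\mathbb{C})$, $\rho(z,z')=\frac1{4\pi i}\frac{z'+z}{z'-z}$. For a connected finite rooted tree $T$ with vertices decorated by $\alpha:T^0\to\Gamma$ and root decoration $\gamma_T$: $W_T=\frac{\mathrm{DT}(\gamma_T)\gamma_T}{|\mathrm{Aut}(T)|}\prod_{v\to w}\langle\mathrm{DT}(\alpha(v))\alpha(v),\alpha(w)\rangle$ (edges oriented towards the root), $G_T(z,Z)=\int_{\ell_{\gamma_T}}\frac{dz'}{z'}\rho(z,z')\,e_{\gamma_T}e^{L(z',Z)(\gamma_T)}\prod_{T'}G_{T'}(z',Z)$, $T'$ running over the trees obtained by removing the root (empty product $=1$). Then $X(z,Z)(e_\alpha)=e_\alpha\exp\big(L(z,Z)(\alpha)-\langle\alpha,\sum_TW_TG_T(z,Z)\rangle\big)$,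 exponential with respect to the commutative product, $z$ off the rays $\ell_\gamma$ with $a(\gamma)\ne0$. The derivative is $(\partial_zX)(e_\alpha)=\partial_z(X(z)(e_\alpha))$, and $(\partial_zX)X^{-1}$ is a composition of linear maps. Formal variables. ${\bf s}=(s_1,\dots,s_m)$, $s_i=e_{\gamma_i}$, ${\bf s}^\alpha=\prod_is_i^{\alpha_i}$; $\Phi_i({\bf s})=L(z,Z)(\gamma_i)-\sum_T\langle\gamma_i,W_T(Z)\rangle G_T(z,Z)\in\mathbb{C}[[{\bf s}]]$, where $e_\alpha$ is replaced by ${\bf s}^\alpha$ throughout; $\partial_q=\partial/\partial s_q$; $[{\bf s}^\alpha]F$ is the coefficient of ${\bf s}^\alpha$ in $F$. *)

theory Defs
  imports "HOL-Analysis.Analysis"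
begin

section \<open>Formal power series in finitely many variables\<close>

text \<open>
  The variables are indexed by a finite type \<open>'m\<close>; a series is its family of coefficients, indexed
  by the exponent vectors in \<open>nat ^ 'm\<close>.
\<close>

typedef ('a, 'm) mfps = "UNIV :: (nat ^ 'm \<Rightarrow> 'a) set"
  morphisms mfps_nth Abs_mfps ..

setup_lifting type_definition_mfps

lemma mfps_eqI: "(\<And>n. mfps_nth f n = mfps_nth g n) \<Longrightarrow> f = g"
  by (simp add: mfps_nth_inject[symmetric] fun_eq_iff)

lemma mfps_nth_Abs [simp]: "mfps_nth (Abs_mfps f) = f"
  by (simp add: Abs_mfps_inverse)

lemma finite_vec_nat_le: "finite {p :: nat ^ 'm::finite. \<forall>i. p $ i \<le> n $ i}"
proof -
  have "finite (vec_nth ` {p :: nat ^ 'm. \<forall>i. p $ i \<le> n $ i})"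
    by (rule finite_subset[of _ "Pi\<^sub>E UNIV (\<lambda>i. {..n $ i})"]) (auto intro: finite_PiE)
  then show ?thesis
    by (rule finite_imageD) (simp add: inj_on_def vec_nth_inject)
qed

lemma finite_vec_nat_splits: "finite {(p, q). p + q = (n :: nat ^ 'm::finite)}"
  by (rule finite_subset[OF _ finite_cartesian_product[OF finite_vec_nat_le finite_vec_nat_le, of n n]])
     auto

instantiation mfps :: (comm_ring_1, finite) comm_ring_1
begin

lift_definition zero_mfps :: "('a, 'b) mfps" is "\<lambda>_. 0" .

lift_definition one_mfps :: "('a, 'b) mfps" is "\<lambda>n. if n = 0 then 1 else 0" .

lift_definition plus_mfps :: "('a, 'b) mfps \<Rightarrow> ('a, 'b) mfps \<Rightarrow> ('a, 'b) mfps"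
  is "\<lambda>f g n. f n + g n" .

lift_definition minus_mfps :: "('a, 'b) mfps \<Rightarrow> ('a, 'b) mfps \<Rightarrow> ('a, 'b) mfps"
  is "\<lambda>f g n. f n - g n" .

lift_definition uminus_mfps :: "('a, 'b) mfps \<Rightarrow> ('a, 'b) mfps"
  is "\<lambda>f n. - f n" .

lift_definition times_mfps :: "('a, 'b) mfps \<Rightarrow> ('a, 'b) mfps \<Rightarrow> ('a, 'b) mfps"
  is "\<lambda>f g n. \<Sum>(p, q)\<in>{(p, q). p + q = n}. f p * g q" .

instance
proof
  fix f g h :: "('a, 'b) mfps"
  show "f + g + h = f + (g + h)" "f + g = g + f" "0 + f = f" "- f + f = 0" "f - g = f + - g"
    by (transfer; simp add: fun_eq_iff add.assoc add.commute)+
  show "(0 :: ('a, 'b) mfps) \<noteq> 1"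
    by transfer (auto simp: fun_eq_iff)
  show "(f + g) * h = f * h + g * h"
    by transfer (simp add: fun_eq_iff sum.distrib[symmetric] distrib_right case_prod_beta)
  show "f * g = g * f"
  proof (transfer, rule ext)
    fix f g :: "nat ^ 'b \<Rightarrow> 'a" and n
    show "(\<Sum>(p, q)\<in>{(p, q). p + q = n}. f p * g q) = (\<Sum>(p, q)\<in>{(p, q). p + q = n}. g p * f q)"
      by (rule sum.reindex_bij_witness[of _ "\<lambda>(p, q). (q, p)" "\<lambda>(p, q). (q, p)"])
         (auto simp: ac_simps)
  qed
  show "1 * f = f"
  proof (transfer, rule ext)
    fix f :: "nat ^ 'b \<Rightarrow> 'a" and n
    have "(\<Sum>(p, q)\<in>{(p, q). p + q = n}. (if p = 0 then 1 else 0) * f q)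
        = (\<Sum>(p, q)\<in>{(0 :: nat ^ 'b, n)}. (if p = 0 then 1 else 0) * f q)"
      by (rule sum.mono_neutral_right) (auto simp: finite_vec_nat_splits split: if_splits)
    then show "(\<Sum>(p, q)\<in>{(p, q). p + q = n}. (if p = 0 then 1 else 0) * f q) = f n"
      by simp
  qed
  show "f * g * h = f * (g * h)"
  proof (transfer, rule ext)
    fix f g h :: "nat ^ 'b \<Rightarrow> 'a" and n
    have "(\<Sum>(u, r)\<in>{(u, r). u + r = n}. (\<Sum>(p, q)\<in>{(p, q). p + q = u}. f p * g q) * h r)
        = (\<Sum>(x, y)\<in>(SIGMA x:{(u, r). u + r = n}. {(p, q). p + q = fst x}).
             f (fst y) * g (snd y) * h (snd x))"
      by (subst sum.Sigma[symmetric])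
         (auto simp: finite_vec_nat_splits sum_distrib_right case_prod_beta intro!: sum.cong)
    also have "\<dots> = (\<Sum>(x, y)\<in>(SIGMA x:{(p, v). p + v = n}. {(q, r). q + r = snd x}).
             f (fst x) * (g (fst y) * h (snd y)))"
      by (rule sum.reindex_bij_witness[of _
            "\<lambda>((p, v), (q, r)). ((p + q, r), (p, q))" "\<lambda>((u, r), (p, q)). ((p, q + r), (q, r))"])
         (auto simp: ac_simps)
    also have "\<dots> = (\<Sum>(p, v)\<in>{(p, v). p + v = n}. f p * (\<Sum>(q, r)\<in>{(q, r). q + r = v}. g q * h r))"
      by (subst sum.Sigma[symmetric])
         (auto simp: finite_vec_nat_splits sum_distrib_left case_prod_beta intro!: sum.cong)
    finally show "(\<Sum>(u, r)\<in>{(u, r). u + r = n}. (\<Sum>(p, q)\<in>{(p, q). p + q = u}. f p * g q) * h r)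
        = (\<Sum>(p, v)\<in>{(p, v). p + v = n}. f p * (\<Sum>(q, r)\<in>{(q, r). q + r = v}. g q * h r))" .
  qed
qed

end

definition mfps_var :: "'m::finite \<Rightarrow> (complex, 'm) mfps" where
  "mfps_var p = Abs_mfps (\<lambda>n. if n = axis p 1 then 1 else 0)"

definition mfps_pderiv :: "'m::finite \<Rightarrow> (complex, 'm) mfps \<Rightarrow> (complex, 'm) mfps" where
  "mfps_pderiv q f = Abs_mfps (\<lambda>n. of_nat (n $ q + 1) * mfps_nth f (n + axis q 1))"

text \<open>
  The constant coefficient of the argument need not vanish: each coefficient of the exponential is
  a convergent series of complex numbers.
\<close>

definition mfps_exp :: "(complex, 'm::finite) mfps \<Rightarrow> (complex, 'm) mfps" where
  "mfps_exp f = Abs_mfps (\<lambda>n. \<Sum>k. mfps_nth (f ^ k) n / fact k)"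


section \<open>Finite rooted trees decorated by lattice elements\<close>

text \<open>
  The constructor orders the subtrees below the root. This order is only a presentation: trees are
  considered up to \<open>tree_iso\<close>, which ignores it, and every finite rooted decorated tree is isomorphic
  to one of this form. A vertex is the list of branch numbers on the path to it from the root.
\<close>

datatype 'g dec_tree = Node (root_dec: 'g) (branches: "'g dec_tree list")

primrec tree_verts :: "'g dec_tree \<Rightarrow> nat list set" where
  "tree_verts (Node g ts) =
     insert [] {i # v | i v. i < length ts \<and> v \<in> map tree_verts ts ! i}"

fun tree_dec :: "'g dec_tree \<Rightarrow> nat list \<Rightarrow> 'g" where
  "tree_dec T [] = root_dec T"
| "tree_dec T (i # v) = tree_dec (branches T ! i) v"

text \<open>Edges \<open>v \<rightarrow> w\<close> point towards the root, that is, \<open>w\<close> is the parent of \<open>v\<close>.\<close>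

definition tree_edges :: "'g dec_tree \<Rightarrow> (nat list \<times> nat list) set" where
  "tree_edges T = {(v, w). v \<in> tree_verts T \<and> w \<in> tree_verts T \<and> (\<exists>i. v = w @ [i])}"

definition tree_iso :: "(nat list \<Rightarrow> nat list) \<Rightarrow> 'g dec_tree \<Rightarrow> 'g dec_tree \<Rightarrow> bool" where
  "tree_iso f T T' \<longleftrightarrow>
     bij_betw f (tree_verts T) (tree_verts T') \<and> f [] = [] \<and>
     (\<forall>v\<in>tree_verts T. \<forall>w\<in>tree_verts T. (v, w) \<in> tree_edges T \<longleftrightarrow> (f v, f w) \<in> tree_edges T') \<and>
     (\<forall>v\<in>tree_verts T. tree_dec T' (f v) = tree_dec T v)"

definition tree_Aut :: "'g dec_tree \<Rightarrow> (nat list \<Rightarrow> nat list) set" where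
  "tree_Aut T = {f. f permutes tree_verts T \<and> tree_iso f T T}"

text \<open>
  Sums over trees are sums over isomorphism classes; we choose one representative in each class
  (the summands only depend on the class).
\<close>

definition tree_reps :: "'g dec_tree set" where
  "tree_reps = (\<lambda>C. SOME T. T \<in> C) ` (UNIV // {(T, T'). \<exists>f. tree_iso f T T'})"


section \<open>Lattices and positive generic stability data\<close>

definition zsmul :: "int \<Rightarrow> 'g::ab_group_add \<Rightarrow> 'g" where
  "zsmul n x = (if 0 \<le> n then (\<Sum>k<nat n. x) else - (\<Sum>k<nat (- n). x))"

text \<open>
  The type \<open>'g\<close> is the lattice \<open>\<Gamma>\<close>, of rank \<open>CARD('m)\<close>, and \<open>charge\<close> is the central charge \<open>Z\<close>. The
  component \<open>a(\<gamma>) = - DT(\<gamma>) e\<^sub>\<gamma>\<close> is recorded by the rational number \<open>DT(\<gamma>)\<close>.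
\<close>

record ('g, 'm) stab =
  pairing :: "'g \<Rightarrow> 'g \<Rightarrow> int"
  pos_cone :: "'g set"
  basis :: "'m \<Rightarrow> 'g"
  charge :: "'g \<Rightarrow> complex"
  DT :: "'g \<Rightarrow> rat"

definition lat_point :: "('g::ab_group_add, 'm::finite) stab \<Rightarrow> int ^ 'm \<Rightarrow> 'g" where
  "lat_point D c = (\<Sum>i\<in>UNIV. zsmul (c $ i) (basis D i))"

definition coords :: "('g::ab_group_add, 'm::finite) stab \<Rightarrow> 'g \<Rightarrow> int ^ 'm" where
  "coords D = inv (lat_point D)"

definition ray :: "('g, 'm) stab \<Rightarrow> 'g \<Rightarrow> complex set" where
  "ray D \<gamma> = {- of_real t * charge D \<gamma> | t. t > 0}"

text \<open>
  Bijectivity of \<open>lat_point\<close> says that \<open>basis\<close> is a basis of \<open>\<Gamma>\<close>. The norm in the support property is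
  the Euclidean norm in this basis; all norms on \<open>\<Gamma> \<otimes> \<real>\<close> give the same condition.
\<close>

locale positive_generic_stability =
  fixes D :: "('g::ab_group_add, 'm::finite) stab"
  assumes pairing_add_left: "pairing D (x + y) w = pairing D x w + pairing D y w"
    and pairing_add_right: "pairing D w (x + y) = pairing D w x + pairing D w y"
    and pairing_skew: "pairing D x y = - pairing D y x"
    and basis: "bij (lat_point D)"
    and cone_zero: "0 \<in> pos_cone D"
    and cone_add: "x \<in> pos_cone D \<Longrightarrow> y \<in> pos_cone D \<Longrightarrow> x + y \<in> pos_cone D"
    and cone_strict: "x \<in> pos_cone D \<Longrightarrow> - x \<in> pos_cone D \<Longrightarrow> x = 0"
    and basis_in_cone: "basis D i \<in> pos_cone D"
    and cone_coords_nonneg: "x \<in> pos_cone D \<Longrightarrow> 0 \<le> coords D x $ i"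
    and charge_add: "charge D (x + y) = charge D x + charge D y"
    and positive: "DT D x \<noteq> 0 \<Longrightarrow> x \<in> pos_cone D"
    and support: "\<exists>C>0. \<forall>x. DT D x \<noteq> 0 \<longrightarrow>
        norm (\<chi> i. real_of_int (coords D x $ i)) \<le> C * cmod (charge D x)"
    and generic: "DT D x \<noteq> 0 \<Longrightarrow> DT D y \<noteq> 0 \<Longrightarrow> ray D x = ray D y \<Longrightarrow> pairing D x y = 0"


section \<open>The completed commutative algebra\<close>

text \<open>
  An element \<open>\<Sum>\<^sub>\<gamma> f\<^sub>\<gamma> e\<^sub>\<gamma>\<close> of the projective limit of the \<open>\<gg>\<^sub>\<ge>\<^sub>0 / \<gg>\<^sub>>\<^sub>k\<close> is given by its family of complex
  coefficients, an arbitrary function supported on \<open>\<Gamma>\<^sub>\<ge>\<^sub>0\<close>: every \<open>\<gg>\<^sub>\<ge>\<^sub>0 / \<gg>\<^sub>>\<^sub>k\<close> is finite-dimensional, with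
  basis the \<open>e\<^sub>\<gamma>\<close> where \<open>\<gamma> \<in> \<Gamma>\<^sub>\<ge>\<^sub>0\<close> has coordinates of sum at most \<open>k\<close>. Limits, infinite sums,
  \<open>z\<close>-derivatives and integrals are taken coefficientwise.
\<close>

definition ghat :: "('g, 'm) stab \<Rightarrow> ('g \<Rightarrow> complex) set" where
  "ghat D = {f. \<forall>\<gamma>. \<gamma> \<notin> pos_cone D \<longrightarrow> f \<gamma> = 0}"

definition gen :: "'g \<Rightarrow> 'g \<Rightarrow> complex" where
  "gen \<gamma> = (\<lambda>\<eta>. if \<eta> = \<gamma> then 1 else 0)"

definition hmult :: "('g::ab_group_add, 'm) stab \<Rightarrow> ('g \<Rightarrow> complex) \<Rightarrow> ('g \<Rightarrow> complex) \<Rightarrow> 'g \<Rightarrow> complex" where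
  "hmult D f g = (\<lambda>\<gamma>. \<Sum>(\<beta>, \<delta>)\<in>{(\<beta>, \<delta>). \<beta> \<in> pos_cone D \<and> \<delta> \<in> pos_cone D \<and> \<beta> + \<delta> = \<gamma>}. f \<beta> * g \<delta>)"

definition hprod :: "('g::ab_group_add, 'm) stab \<Rightarrow> ('g \<Rightarrow> complex) list \<Rightarrow> 'g \<Rightarrow> complex" where
  "hprod D fs = foldr (hmult D) fs (gen 0)"

definition hexp :: "('g::ab_group_add, 'm) stab \<Rightarrow> ('g \<Rightarrow> complex) \<Rightarrow> 'g \<Rightarrow> complex" where
  "hexp D f = (\<lambda>\<gamma>. \<Sum>k. hprod D (replicate k f) \<gamma> / fact k)"

definition dz :: "(complex \<Rightarrow> 'g \<Rightarrow> complex) \<Rightarrow> complex \<Rightarrow> 'g \<Rightarrow> complex" where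
  "dz F z = (\<lambda>\<gamma>. deriv (\<lambda>w. F w \<gamma>) z)"

text \<open>The continuous linear map on \<open>ghat\<close> that sends \<open>e\<^sub>\<alpha>\<close> to \<open>\<phi> \<alpha>\<close>.\<close>

definition lin_ext :: "('g, 'm) stab \<Rightarrow> ('g \<Rightarrow> 'g \<Rightarrow> complex) \<Rightarrow> ('g \<Rightarrow> complex) \<Rightarrow> 'g \<Rightarrow> complex" where
  "lin_ext D \<phi> f = (\<lambda>\<gamma>. \<Sum>\<^sub>\<infinity>\<alpha>\<in>pos_cone D. f \<alpha> * \<phi> \<alpha> \<gamma>)"


section \<open>The function \<open>X\<close>\<close>

definition rat_coords :: "('g::ab_group_add, 'm::finite) stab \<Rightarrow> 'g \<Rightarrow> rat ^ 'm" where
  "rat_coords D \<gamma> = (\<chi> i. of_int (coords D \<gamma> $ i))"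

text \<open>The bilinear extension of the form to \<open>\<Gamma> \<otimes> \<rat>\<close>, which is \<open>rat ^ 'm\<close> in the given basis.\<close>

definition pairing_rat :: "('g, 'm::finite) stab \<Rightarrow> rat ^ 'm \<Rightarrow> rat ^ 'm \<Rightarrow> rat" where
  "pairing_rat D v w = (\<Sum>i\<in>UNIV. \<Sum>j\<in>UNIV. v $ i * w $ j * of_int (pairing D (basis D i) (basis D j)))"

definition W :: "('g::ab_group_add, 'm::finite) stab \<Rightarrow> 'g dec_tree \<Rightarrow> rat ^ 'm" where
  "W D T =
     (1 / of_nat (card (tree_Aut T)) *
      (\<Prod>(v, w)\<in>tree_edges T.
         pairing_rat D (DT D (tree_dec T v) *s rat_coords D (tree_dec T v)) (rat_coords D (tree_dec T w))))
     *s (DT D (root_dec T) *s rat_coords D (root_dec T))"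

definition L :: "('g, 'm) stab \<Rightarrow> complex \<Rightarrow> 'g \<Rightarrow> complex" where
  "L D z \<gamma> = inverse z * charge D \<gamma> + z * cnj (charge D \<gamma>)"

definition rho :: "complex \<Rightarrow> complex \<Rightarrow> complex" where
  "rho z z' = 1 / (4 * of_real pi * \<i>) * ((z' + z) / (z' - z))"

text \<open>The integral of \<open>f(z') dz'\<close> over the ray \<open>\<real>\<^sub>>\<^sub>0 w\<close>, oriented from \<open>0\<close> to infinity.\<close>

definition ray_integral :: "complex \<Rightarrow> (complex \<Rightarrow> complex) \<Rightarrow> complex" where
  "ray_integral w f = (LINT t:{0<..}|lborel. f (of_real t * w) * w)"

fun G :: "('g::ab_group_add, 'm) stab \<Rightarrow> 'g dec_tree \<Rightarrow> complex \<Rightarrow> 'g \<Rightarrow> complex" where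
  "G D (Node \<gamma> ts) z = (\<lambda>\<eta>. ray_integral (- charge D \<gamma>)
     (\<lambda>z'. 1 / z' * rho z z' * exp (L D z' \<gamma>) *
        hmult D (gen \<gamma>) (hprod D (map (\<lambda>T'. G D T' z') ts)) \<eta>))"

text \<open>
  \<open>pair_trees D \<alpha> F\<close> is \<open>\<langle>\<alpha>, \<Sum>\<^sub>T W\<^sub>T F\<^sub>T\<rangle>\<close>. A tree with a decoration that is zero or outside the cone has
  \<open>W\<^sub>T = 0\<close>, so that for \<open>F = G\<close> only finitely many trees contribute to a given coefficient.
\<close>

definition pair_trees ::
  "('g::ab_group_add, 'm::finite) stab \<Rightarrow> 'g \<Rightarrow> ('g dec_tree \<Rightarrow> 'g \<Rightarrow> complex) \<Rightarrow> 'g \<Rightarrow> complex" where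
  "pair_trees D \<alpha> F = (\<lambda>\<gamma>. \<Sum>\<^sub>\<infinity>T\<in>tree_reps. of_rat (pairing_rat D (rat_coords D \<alpha>) (W D T)) * F T \<gamma>)"

definition X_exponent :: "('g::ab_group_add, 'm::finite) stab \<Rightarrow> complex \<Rightarrow> 'g \<Rightarrow> 'g \<Rightarrow> complex" where
  "X_exponent D z \<alpha> = (\<lambda>\<gamma>. L D z \<alpha> * gen 0 \<gamma> - pair_trees D \<alpha> (\<lambda>T. G D T z) \<gamma>)"

definition X :: "('g::ab_group_add, 'm::finite) stab \<Rightarrow> complex \<Rightarrow> ('g \<Rightarrow> complex) \<Rightarrow> 'g \<Rightarrow> complex" where
  "X D z = lin_ext D (\<lambda>\<alpha>. hmult D (gen \<alpha>) (hexp D (X_exponent D z \<alpha>)))"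

definition dX :: "('g::ab_group_add, 'm::finite) stab \<Rightarrow> complex \<Rightarrow> ('g \<Rightarrow> complex) \<Rightarrow> 'g \<Rightarrow> complex" where
  "dX D z = lin_ext D (\<lambda>\<alpha>. dz (\<lambda>w. X D w (gen \<alpha>)) z)"

definition conn_A :: "('g::ab_group_add, 'm::finite) stab \<Rightarrow> complex \<Rightarrow> ('g \<Rightarrow> complex) \<Rightarrow> 'g \<Rightarrow> complex" where
  "conn_A D z f = - dX D z (inv_into (ghat D) (X D z) f)"


section \<open>Passage to formal variables\<close>

text \<open>Replaces \<open>e\<^sub>\<alpha>\<close> by the monomial \<open>s\<^sup>\<alpha>\<close>.\<close>

definition to_mfps :: "('g::ab_group_add, 'm::finite) stab \<Rightarrow> ('g \<Rightarrow> complex) \<Rightarrow> (complex, 'm) mfps" where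
  "to_mfps D f = Abs_mfps (\<lambda>n. f (lat_point D (\<chi> i. int (n $ i))))"

definition exponent :: "('g::ab_group_add, 'm::finite) stab \<Rightarrow> 'g \<Rightarrow> nat ^ 'm" where
  "exponent D \<alpha> = (\<chi> i. nat (coords D \<alpha> $ i))"

definition Phi :: "('g::ab_group_add, 'm::finite) stab \<Rightarrow> complex \<Rightarrow> 'm \<Rightarrow> (complex, 'm) mfps" where
  "Phi D z i = to_mfps D (X_exponent D z (basis D i))"

end

theory Submission
  imports Defs
begin

text \<open>
  Since \<open>\<Gamma>\<^sub>\<ge>\<^sub>0\<close> contains the basis and has nonnegative coordinates, it is \<open>\<nat>\<^sup>m\<close>, and the completed algebra is
  \<open>\<complex>[[s]]\<close>; there \<open>X\<close> is the substitution \<open>s\<^sub>i \<mapsto> s\<^sub>i exp \<Phi>\<^sub>i\<close>. By the chain rule, \<open>\<partial>\<^sub>z X\<close> sends \<open>e\<^sub>\<alpha>\<close> to \<open>X(e\<^sub>\<alpha>)\<close>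
  times the derivative of its exponent, so it remains to expand \<open>s\<^sub>i\<close> in the series \<open>X(e\<^sub>\<alpha>)\<close>, which is the
  multivariate Lagrange inversion formula. It amounts to
  \<open>[s\<^sup>n] (det(\<delta>\<^sub>p\<^sub>q + s\<^sub>q \<partial>\<^sub>q \<Phi>\<^sub>p) exp(- n \<cdot> \<Phi>)) = 0\<close> for \<open>n \<noteq> 0\<close>: in the expansion of the determinant by rows into
  monomials \<open>s^(k\<^sub>p)\<close>, row \<open>p\<close> becomes a multiple of \<open>n\<^sub>p \<delta>\<^sub>p\<^sub>q - k\<^sub>p\<^sub>q\<close> (when all \<open>n\<^sub>p \<noteq> 0\<close>), and \<open>\<Sum>\<^sub>p k\<^sub>p = n\<close> says that
  these rows sum to zero. The chain rule needs every \<open>G\<^sub>T\<close> with \<open>W\<^sub>T \<noteq> 0\<close> to be holomorphic off the ray of its root;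
  this holds by induction on \<open>T\<close>, together with boundedness on all other rays through the origin, as the rays of a
  vertex and of its parent are distinct by genericity.
\<close>

section \<open>Arithmetic of multivariate power series\<close>

definition mfps_monom :: "nat ^ 'm::finite \<Rightarrow> (complex, 'm) mfps" where
  "mfps_monom a = Abs_mfps (\<lambda>n. if n = a then 1 else 0)"

text \<open>The operator \<open>s_q \<partial>_q\<close>. Being diagonal on monomials, it gives
  recursions for coefficients without an index shift.\<close>

definition mfps_euler :: "'m::finite \<Rightarrow> (complex, 'm) mfps \<Rightarrow> (complex, 'm) mfps" where
  "mfps_euler q f = Abs_mfps (\<lambda>n. of_nat (n $ q) * mfps_nth f n)"

definition vdeg :: "nat ^ 'm::finite \<Rightarrow> nat" where
  "vdeg n = (\<Sum>i\<in>UNIV. n $ i)"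

lemma vdeg_add: "vdeg (p + q) = vdeg p + vdeg q"
  by (simp add: vdeg_def sum.distrib)

lemma vdeg_eq_0_iff: "vdeg p = 0 \<longleftrightarrow> p = 0"
  by (simp add: vdeg_def vec_eq_iff)

lemma mfps_nth_times:
  "mfps_nth (f * g) n = (\<Sum>(p, q)\<in>{(p, q). p + q = n}. mfps_nth f p * mfps_nth g q)"
  by (simp add: times_mfps.rep_eq)

lemma mfps_nth_simps [simp]:
  "mfps_nth 0 n = 0" "mfps_nth 1 n = (if n = 0 then 1 else 0)"
  "mfps_nth (f + g) n = mfps_nth f n + mfps_nth g n"
  "mfps_nth (f - g) n = mfps_nth f n - mfps_nth g n"
  "mfps_nth (- f) n = - mfps_nth f n"
  by (simp_all add: zero_mfps.rep_eq one_mfps.rep_eq plus_mfps.rep_eq minus_mfps.rep_eq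
        uminus_mfps.rep_eq)

lemma mfps_nth_sum [simp]: "mfps_nth (\<Sum>x\<in>S. f x) n = (\<Sum>x\<in>S. mfps_nth (f x) n)"
  by (induction S rule: infinite_finite_induct) auto

lemma mfps_nth_of_nat_mult [simp]: "mfps_nth (of_nat k * f) n = of_nat k * mfps_nth f n"
  by (induction k) (auto simp: distrib_right)

lemma mfps_nth_of_int_mult [simp]: "mfps_nth (of_int k * f) n = of_int k * mfps_nth f n"
  by (cases k rule: int_cases2) simp_all

lemma mfps_nth_euler [simp]: "mfps_nth (mfps_euler q f) n = of_nat (n $ q) * mfps_nth f n"
  by (simp add: mfps_euler_def)

lemma splits_0: "{(p, q). p + q = (0 :: nat ^ 'm::finite)} = {(0, 0)}"
  by (auto simp: vec_eq_iff)

lemma mfps_nth_times_0 [simp]: "mfps_nth (f * g) 0 = mfps_nth f 0 * mfps_nth g 0"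
  by (simp add: mfps_nth_times splits_0)

lemma mfps_nth_power_0 [simp]: "mfps_nth (f ^ k) 0 = mfps_nth f 0 ^ k"
  by (induction k) simp_all

lemma mfps_nth_monom_times_add: "mfps_nth (mfps_monom a * f) (a + n) = mfps_nth f n"
proof -
  have "mfps_nth (mfps_monom a * f) (a + n)
      = (\<Sum>(p, q)\<in>{(a, n)}. mfps_nth (mfps_monom a) p * mfps_nth f q)"
    unfolding mfps_nth_times
    by (rule sum.mono_neutral_right) (auto simp: finite_vec_nat_splits mfps_monom_def split: if_splits)
  then show ?thesis by (simp add: mfps_monom_def)
qed

lemma mfps_nth_monom_times_eq_0:
  assumes "\<And>q. n \<noteq> a + q"
  shows "mfps_nth (mfps_monom a * f) n = 0"
  unfolding mfps_nth_times using assms by (intro sum.neutral) (auto simp: mfps_monom_def)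

lemma mfps_var_times_pderiv: "mfps_var q * mfps_pderiv q f = mfps_euler q f"
proof (rule mfps_eqI)
  fix n
  have v: "mfps_var q = mfps_monom (axis q 1)"
    by (simp add: mfps_var_def mfps_monom_def)
  show "mfps_nth (mfps_var q * mfps_pderiv q f) n = mfps_nth (mfps_euler q f) n"
  proof (cases "\<exists>r. n = axis q 1 + r")
    case True
    then obtain r where r: "n = axis q 1 + r" by blast
    show ?thesis
      unfolding v r mfps_nth_monom_times_add
      by (simp add: mfps_pderiv_def add.commute)
  next
    case False
    \<comment> \<open>Were the entry positive, subtracting \<open>axis q 1\<close> would give the
      excluded decomposition. As it is zero, both sides vanish.\<close>
    have "n $ q = 0"
    proof (rule ccontr)
      assume "n $ q \<noteq> 0"
      then have "n = axis q 1 + (\<chi> i. n $ i - axis q 1 $ i)"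
        by (auto simp: vec_eq_iff axis_def)
      with False show False by blast
    qed
    then show ?thesis using False
      by (simp add: v mfps_nth_monom_times_eq_0)
  qed
qed

section \<open>Derivation rules for the Euler operators\<close>

lemma mfps_euler_add: "mfps_euler q (f + g) = mfps_euler q f + mfps_euler q g"
  by (rule mfps_eqI) (simp add: algebra_simps)

lemma mfps_euler_diff: "mfps_euler q (f - g) = mfps_euler q f - mfps_euler q g"
  by (rule mfps_eqI) (simp add: algebra_simps)

lemma mfps_euler_minus: "mfps_euler q (- f) = - mfps_euler q f"
  by (rule mfps_eqI) simp

lemma mfps_euler_of_nat_mult: "mfps_euler q (of_nat k * f) = of_nat k * mfps_euler q f"
  by (rule mfps_eqI) simp

lemma mfps_euler_times: "mfps_euler q (f * g) = mfps_euler q f * g + f * mfps_euler q g"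
proof (rule mfps_eqI)
  fix n
  show "mfps_nth (mfps_euler q (f * g)) n = mfps_nth (mfps_euler q f * g + f * mfps_euler q g) n"
    unfolding mfps_nth_simps mfps_nth_euler mfps_nth_times sum_distrib_left sum.distrib[symmetric]
    by (rule sum.cong) (auto simp: algebra_simps)
qed

lemma mfps_euler_power: "mfps_euler q (f ^ Suc k) = of_nat (Suc k) * (mfps_euler q f * f ^ k)"
proof (induction k)
  case (Suc k)
  have "mfps_euler q (f ^ Suc (Suc k)) = mfps_euler q f * f ^ Suc k + f * mfps_euler q (f ^ Suc k)"
    by (simp add: mfps_euler_times)
  also have "\<dots> = of_nat (Suc (Suc k)) * (mfps_euler q f * f ^ Suc k)"
    by (subst Suc.IH) (simp add: algebra_simps)
  finally show ?case .
qed simp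


section \<open>The exponential of a power series\<close>

text \<open>The l1 norm of the truncation to exponents below \<open>n\<close>. It is
  submultiplicative, so a coefficient of \<open>f ^ k\<close> grows at most geometrically in
  \<open>k\<close>, which makes the exponential series converge.\<close>

definition mfps_box_norm :: "nat ^ 'm::finite \<Rightarrow> (complex, 'm) mfps \<Rightarrow> real" where
  "mfps_box_norm n f = (\<Sum>p\<in>{p. \<forall>i. p $ i \<le> n $ i}. cmod (mfps_nth f p))"

text \<open>If a sum of two exponents lies in the box, so do both summands; hence the terms on the
  left are among those of the product of the two sums.\<close>

lemma mfps_box_norm_times:
  fixes f g :: "(complex, 'm::finite) mfps"
  shows "mfps_box_norm n (f * g) \<le> mfps_box_norm n f * mfps_box_norm n g"
proof -
  let ?B = "{p. \<forall>i. p $ i \<le> n $ i}"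
  let ?h = "\<lambda>x. cmod (mfps_nth f (fst x)) * cmod (mfps_nth g (snd x))"
  have "mfps_box_norm n (f * g) \<le> (\<Sum>p\<in>?B. \<Sum>x\<in>{(a, b). a + b = p}. ?h x)"
    unfolding mfps_box_norm_def mfps_nth_times case_prod_beta
    by (intro sum_mono order.trans[OF norm_sum]) (simp add: norm_mult)
  also have "\<dots> = (\<Sum>y\<in>(SIGMA p:?B. {(a, b). a + b = p}). ?h (snd y))"
    by (subst sum.Sigma) (auto simp: finite_vec_nat_le finite_vec_nat_splits case_prod_beta)
  also have "\<dots> = (\<Sum>x\<in>{x. fst x + snd x \<in> ?B}. ?h x)"
    by (rule sum.reindex_bij_witness[of _ "\<lambda>x. (fst x + snd x, x)" snd]) auto
  also have "\<dots> \<le> (\<Sum>x\<in>?B \<times> ?B. ?h x)"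
  proof (rule sum_mono2)
    show "{x. fst x + snd x \<in> ?B} \<subseteq> ?B \<times> ?B"
    proof
      fix x :: "(nat ^ 'm) \<times> (nat ^ 'm)"
      assume "x \<in> {x. fst x + snd x \<in> ?B}"
      then have "fst x $ i + snd x $ i \<le> n $ i" for i by simp
      then have "fst x $ i \<le> n $ i" "snd x $ i \<le> n $ i" for i
        using add_leD1 add_leD2 by blast+
      then show "x \<in> ?B \<times> ?B" by (cases x) auto
    qed
  qed (auto simp: finite_vec_nat_le)
  also have "\<dots> = mfps_box_norm n f * mfps_box_norm n g"
    by (simp add: mfps_box_norm_def sum_product sum.cartesian_product case_prod_beta)
  finally show ?thesis .
qed

lemma norm_mfps_nth_power_le:
  fixes f :: "(complex, 'm::finite) mfps"
  shows "cmod (mfps_nth (f ^ k) n) \<le> mfps_box_norm n f ^ k"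
proof -
  have nn: "0 \<le> mfps_box_norm n f" by (simp add: mfps_box_norm_def sum_nonneg)
  have "mfps_box_norm n (f ^ k) \<le> mfps_box_norm n f ^ k"
  proof (induction k)
    case 0
    have "mfps_box_norm n (1 :: (complex, 'm) mfps) = (\<Sum>p\<in>{0 :: nat ^ 'm}. 1)"
      unfolding mfps_box_norm_def
      by (rule sum.mono_neutral_cong_right) (auto simp: finite_vec_nat_le)
    then show ?case by simp
  next
    case (Suc k)
    have "mfps_box_norm n (f ^ Suc k) \<le> mfps_box_norm n f * mfps_box_norm n (f ^ k)"
      by (simp add: mfps_box_norm_times)
    also have "\<dots> \<le> mfps_box_norm n f ^ Suc k"
      using mult_left_mono[OF Suc.IH nn] by simp
    finally show ?case .
  qed
  moreover have "cmod (mfps_nth (f ^ k) n) \<le> mfps_box_norm n (f ^ k)"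
    unfolding mfps_box_norm_def by (rule member_le_sum) (auto simp: finite_vec_nat_le)
  ultimately show ?thesis by simp
qed

lemma mfps_exp_sums: "(\<lambda>k. mfps_nth (f ^ k) n / fact k) sums mfps_nth (mfps_exp f) n"
proof -
  have "summable (\<lambda>k. mfps_nth (f ^ k) n / fact k)"
  proof (rule summable_comparison_test')
    show "summable (\<lambda>k. inverse (fact k) * mfps_box_norm n f ^ k)"
      by (rule summable_exp)
    show "norm (mfps_nth (f ^ k) n / fact k) \<le> inverse (fact k) * mfps_box_norm n f ^ k" for k
      using norm_mfps_nth_power_le[of f k n] by (simp add: norm_divide divide_simps)
  qed
  then show ?thesis by (simp add: mfps_exp_def summable_sums)
qed

lemma mfps_nth_exp_0: "mfps_nth (mfps_exp f) 0 = exp (mfps_nth f 0)"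
proof (rule sums_unique2[OF mfps_exp_sums])
  show "(\<lambda>k. mfps_nth (f ^ k) 0 / fact k) sums exp (mfps_nth f 0)"
    using exp_converges[of "mfps_nth f 0"] by (simp add: scaleR_conv_of_real field_simps)
qed

text \<open>Termwise, the Euler operator sends \<open>f ^ Suc k / fact (Suc k)\<close> to
  \<open>f ^ k / fact k\<close> times the Euler derivative of \<open>f\<close>. A coefficient of a
  product is a finite sum, so multiplication commutes with the series.\<close>

lemma mfps_euler_exp: "mfps_euler q (mfps_exp f) = mfps_euler q f * mfps_exp f"
proof (rule mfps_eqI)
  fix n
  have "(\<lambda>k. \<Sum>(p, r)\<in>{(p, r). p + r = n}. mfps_nth (mfps_euler q f) p * (mfps_nth (f ^ k) r / fact k))
     sums (\<Sum>(p, r)\<in>{(p, r). p + r = n}. mfps_nth (mfps_euler q f) p * mfps_nth (mfps_exp f) r)"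
    unfolding case_prod_beta by (intro sums_sum sums_mult mfps_exp_sums)
  moreover have "(\<Sum>(p, r)\<in>{(p, r). p + r = n}. mfps_nth (mfps_euler q f) p * (mfps_nth (f ^ k) r / fact k))
     = mfps_nth (mfps_euler q f * f ^ k) n / fact k" for k
    by (simp add: mfps_nth_times sum_divide_distrib case_prod_beta del: mfps_nth_euler)
  moreover have "mfps_nth (mfps_euler q f * f ^ k) n / fact k
      = of_nat (n $ q) * (mfps_nth (f ^ Suc k) n / fact (Suc k))" for k
  proof -
    have "of_nat (n $ q) * mfps_nth (f ^ Suc k) n = of_nat (Suc k) * mfps_nth (mfps_euler q f * f ^ k) n"
      using arg_cong[OF mfps_euler_power[of q f k], of "\<lambda>F. mfps_nth F n"]
      by (simp only: mfps_nth_euler mfps_nth_of_nat_mult)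
    moreover have "fact (Suc k) = of_nat (Suc k) * (fact k :: complex)"
      by (simp add: fact_Suc)
    ultimately show ?thesis
      by (simp only: times_divide_eq_right mult_divide_mult_cancel_left_if of_nat_eq_0_iff) simp
  qed
  ultimately have "(\<lambda>k. of_nat (n $ q) * (mfps_nth (f ^ Suc k) n / fact (Suc k)))
       sums mfps_nth (mfps_euler q f * mfps_exp f) n"
    by (simp add: mfps_nth_times del: mfps_nth_euler)
  then have "(\<lambda>k. of_nat (n $ q) * (mfps_nth (f ^ k) n / fact k))
       sums (mfps_nth (mfps_euler q f * mfps_exp f) n + of_nat (n $ q) * (mfps_nth (f ^ 0) n / fact 0))"
    by (subst (asm) sums_Suc_iff) simp
  \<comment> \<open>The extra term of the shifted series vanishes: \<open>f ^ 0 = 1\<close> has only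
    a constant coefficient, and there \<open>n $ q = 0\<close>.\<close>
  then have "(\<lambda>k. of_nat (n $ q) * (mfps_nth (f ^ k) n / fact k))
       sums mfps_nth (mfps_euler q f * mfps_exp f) n"
    by (auto split: if_splits)
  moreover have "(\<lambda>k. of_nat (n $ q) * (mfps_nth (f ^ k) n / fact k))
       sums mfps_nth (mfps_euler q (mfps_exp f)) n"
    using sums_mult[OF mfps_exp_sums[of f n], of "of_nat (n $ q)"] by (simp only: mfps_nth_euler)
  ultimately show "mfps_nth (mfps_euler q (mfps_exp f)) n = mfps_nth (mfps_euler q f * mfps_exp f) n"
    using sums_unique2 by blast
qed

text \<open>Uniqueness for a first-order linear system. At an exponent \<open>n\<close> with
  \<open>n $ q \<noteq> 0\<close>, only splits \<open>n = p + r\<close> with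
  \<open>p $ q \<noteq> 0\<close> contribute, so the coefficient of \<open>K\<close> at
  \<open>n\<close> is determined by those of lower degree.\<close>

lemma mfps_euler_ode_zero:
  assumes "mfps_nth K 0 = 0" and ode: "\<And>q. mfps_euler q K = mfps_euler q f * K"
  shows "K = 0"
proof -
  have "mfps_nth K n = 0" for n
  proof (induction "vdeg n" arbitrary: n rule: less_induct)
    case less
    show ?case
    proof (cases "n = 0")
      case False
      then obtain q where q: "n $ q \<noteq> 0" by (auto simp: vec_eq_iff)
      have "of_nat (n $ q) * mfps_nth K n = mfps_nth (mfps_euler q f * K) n"
        by (simp flip: ode)
      also have "\<dots> = 0"
        unfolding mfps_nth_times
      proof (rule sum.neutral, safe)
        fix p r assume n: "n = p + r"
        show "mfps_nth (mfps_euler q f) p * mfps_nth K r = 0"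
        proof (cases "p $ q = 0")
          case False
          then have "p \<noteq> 0" by auto
          then show ?thesis using less[of r] vdeg_eq_0_iff[of p] n by (simp add: vdeg_add)
        qed simp
      qed
      finally show ?thesis using q by simp
    qed (use assms in simp)
  qed
  then show ?thesis by (auto intro: mfps_eqI)
qed

text \<open>Both sides solve the same linear system and have the same constant coefficient, by the
  functional equation of the complex exponential.\<close>

lemma mfps_exp_add: "mfps_exp (f + g) = mfps_exp f * mfps_exp g"
proof -
  have "mfps_exp (f + g) - mfps_exp f * mfps_exp g = 0"
    by (rule mfps_euler_ode_zero[where f = "f + g"])
       (simp_all add: mfps_nth_exp_0 exp_add mfps_euler_diff mfps_euler_times mfps_euler_exp
         mfps_euler_add algebra_simps)
  then show ?thesis by simp
qed

lemma mfps_exp_0 [simp]: "mfps_exp 0 = 1"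
proof -
  have "mfps_exp 0 - 1 = (0 :: (complex, 'a) mfps)"
  proof (rule mfps_euler_ode_zero[where f = 0])
    fix q :: 'a
    have e: "mfps_euler q 0 = 0" "mfps_euler q 1 = 0" by (rule mfps_eqI; simp)+
    show "mfps_euler q (mfps_exp 0 - 1) = mfps_euler q 0 * (mfps_exp 0 - 1)"
      by (simp add: mfps_euler_diff mfps_euler_exp e)
  qed (simp add: mfps_nth_exp_0)
  then show ?thesis by simp
qed

lemma mfps_exp_sum: "finite S \<Longrightarrow> mfps_exp (\<Sum>x\<in>S. f x) = (\<Prod>x\<in>S. mfps_exp (f x))"
  by (induction S rule: finite_induct) (auto simp: mfps_exp_add)

text \<open>The chain rule, coefficient by coefficient. No series is differentiated termwise: the
  Euler equation of the exponential writes a coefficient as a finite sum over coefficients of lower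
  degree, and induction on the degree applies.\<close>

lemma mfps_exp_has_field_derivative:
  assumes f: "\<And>n. ((\<lambda>w. mfps_nth (f w) n) has_field_derivative mfps_nth f' n) (at z)"
  shows "((\<lambda>w. mfps_nth (mfps_exp (f w)) n) has_field_derivative
           mfps_nth (mfps_exp (f z) * f') n) (at z)"
proof (induction "vdeg n" arbitrary: n rule: less_induct)
  case less
  let ?S = "{(p, r). p + r = n}"
  show ?case
  proof (cases "n = 0")
    case True
    then show ?thesis using f[of 0]
      by (auto simp: mfps_nth_exp_0 intro!: derivative_eq_intros)
  next
    case False
    then obtain q where q: "n $ q \<noteq> 0" by (auto simp: vec_eq_iff)
    let ?s = "\<lambda>w. \<Sum>(p, r)\<in>?S. of_nat (p $ q) * mfps_nth (f w) p * mfps_nth (mfps_exp (f w)) r"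
    have s: "mfps_nth (mfps_exp (f w)) n = ?s w / of_nat (n $ q)" for w
    proof -
      have "of_nat (n $ q) * mfps_nth (mfps_exp (f w)) n = ?s w"
        using arg_cong[OF mfps_euler_exp[of q "f w"], of "\<lambda>F. mfps_nth F n"]
        by (simp only: mfps_nth_times mfps_nth_euler)
      then show ?thesis using q by (simp add: field_simps)
    qed
    have d: "((\<lambda>w. of_nat (p $ q) * mfps_nth (f w) p * mfps_nth (mfps_exp (f w)) r) has_field_derivative
        mfps_nth (mfps_euler q f') p * mfps_nth (mfps_exp (f z)) r
        + mfps_nth (mfps_euler q (f z)) p * mfps_nth (mfps_exp (f z) * f') r) (at z)"
      if "p + r = n" for p r
    proof (cases "p $ q = 0")
      case False
      then have "p \<noteq> 0" by auto
      then have "vdeg r < vdeg n" using that vdeg_eq_0_iff[of p] by (auto simp: vdeg_add)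
      note less[OF this]
      then show ?thesis
        by (auto intro!: derivative_eq_intros f simp: algebra_simps)
    qed simp
    have "(?s has_field_derivative (\<Sum>(p, r)\<in>?S. mfps_nth (mfps_euler q f') p * mfps_nth (mfps_exp (f z)) r
        + mfps_nth (mfps_euler q (f z)) p * mfps_nth (mfps_exp (f z) * f') r)) (at z)"
      unfolding case_prod_beta by (rule DERIV_sum) (rule d, auto)
    \<comment> \<open>The differentiated recursion is exactly the recursion satisfied by
      \<open>exp (f z) * f'\<close>.\<close>
    also have "(\<Sum>(p, r)\<in>?S. mfps_nth (mfps_euler q f') p * mfps_nth (mfps_exp (f z)) r
        + mfps_nth (mfps_euler q (f z)) p * mfps_nth (mfps_exp (f z) * f') r)
        = mfps_nth (mfps_euler q (mfps_exp (f z) * f')) n"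
    proof -
      have "mfps_euler q (mfps_exp (f z) * f')
          = mfps_euler q f' * mfps_exp (f z) + mfps_euler q (f z) * (mfps_exp (f z) * f')"
        by (simp add: mfps_euler_times mfps_euler_exp algebra_simps)
      then show ?thesis
        by (simp only: mfps_nth_simps mfps_nth_times[of "mfps_euler q f'"]
              mfps_nth_times[of "mfps_euler q (f z)"] split_def sum.distrib)
    qed
    finally have "(?s has_field_derivative of_nat (n $ q) * mfps_nth (mfps_exp (f z) * f') n) (at z)"
      by simp
    from DERIV_cdivide[OF this, of "of_nat (n $ q)"] show ?thesis
      using q by (simp add: s[abs_def])
  qed
qed


section \<open>Lagrange inversion in several variables\<close>

text \<open>The index \<open>k\<close> assigns an exponent to every factor; it is set to zero
  outside \<open>S\<close> so that there are only finitely many. Finiteness is carried along because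
  the induction step sums over these sets.\<close>

lemma mfps_nth_prod:
  fixes f :: "'a \<Rightarrow> (complex, 'm::finite) mfps"
  assumes "finite S"
  shows "mfps_nth (\<Prod>p\<in>S. f p) n
    = (\<Sum>k\<in>{k. (\<forall>p. p \<notin> S \<longrightarrow> k p = 0) \<and> sum k S = n}. \<Prod>p\<in>S. mfps_nth (f p) (k p))
    \<and> finite {k :: 'a \<Rightarrow> nat ^ 'm. (\<forall>p. p \<notin> S \<longrightarrow> k p = 0) \<and> sum k S = n}"
  using assms
proof (induction S arbitrary: n rule: finite_induct)
  case empty
  have "{k :: 'a \<Rightarrow> nat ^ 'm. (\<forall>p. k p = 0) \<and> 0 = n} = (if n = 0 then {\<lambda>_. 0} else {})"
    by (auto simp: fun_eq_iff)
  then show ?case by simp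
next
  case (insert x S)
  let ?K = "\<lambda>S n. {k :: 'a \<Rightarrow> nat ^ 'm. (\<forall>p. p \<notin> S \<longrightarrow> k p = 0) \<and> sum k S = n}"
  let ?Sg = "SIGMA y:{(a, b). a + b = n}. ?K S (snd y)"
  have upd: "sum (k(x := a)) S = sum k S" "(\<Prod>p\<in>S. mfps_nth (f p) ((k(x := a)) p)) = (\<Prod>p\<in>S. mfps_nth (f p) (k p))"
    for k :: "'a \<Rightarrow> nat ^ 'm" and a
    by (rule sum.cong prod.cong; use insert.hyps in auto)+
  \<comment> \<open>Mutually inverse maps: one inserts the exponent of the new factor
    \<open>x\<close>, the other splits it off.\<close>
  let ?i = "\<lambda>(y, k). k(x := fst y)" and ?j = "\<lambda>k. ((k x, sum k S), k(x := 0))"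
  have fin: "finite ?Sg"
    using insert.IH by (intro finite_SigmaI finite_vec_nat_splits) auto
  have i: "?i u \<in> ?K (insert x S) n \<and> ?j (?i u) = u" if "u \<in> ?Sg" for u
  proof -
    from that obtain a b k where u: "u = ((a, b), k)" "a + b = n" "\<forall>p. p \<notin> S \<longrightarrow> k p = 0" "sum k S = b"
      by auto
    then have "k x = 0" using insert.hyps by auto
    with u show ?thesis using insert.hyps by (simp add: upd[unfolded fun_upd_def] fun_eq_iff)
  qed
  have j: "?j k \<in> ?Sg \<and> ?i (?j k) = k" if "k \<in> ?K (insert x S) n" for k
    using that insert.hyps by (auto simp: upd[unfolded fun_upd_def])
  have "mfps_nth (\<Prod>p\<in>insert x S. f p) n
     = (\<Sum>y\<in>{(a, b). a + b = n}. \<Sum>k\<in>?K S (snd y). mfps_nth (f x) (fst y) * (\<Prod>p\<in>S. mfps_nth (f p) (k p)))"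
    using insert by (simp add: mfps_nth_times case_prod_beta sum_distrib_left)
  also have "\<dots> = (\<Sum>(y, k)\<in>?Sg. mfps_nth (f x) (fst y) * (\<Prod>p\<in>S. mfps_nth (f p) (k p)))"
    using insert.IH by (intro sum.Sigma finite_vec_nat_splits) auto
  also have "\<dots> = (\<Sum>k\<in>?K (insert x S) n. mfps_nth (f x) (k x) * (\<Prod>p\<in>S. mfps_nth (f p) (k p)))"
    by (rule sum.reindex_bij_witness[of _ ?j ?i]) (use i j in \<open>auto simp: upd[unfolded fun_upd_def]\<close>)
  finally have "mfps_nth (\<Prod>p\<in>insert x S. f p) n = (\<Sum>k\<in>?K (insert x S) n. \<Prod>p\<in>insert x S. mfps_nth (f p) (k p))"
    using insert.hyps by simp
  moreover have "finite (?K (insert x S) n)"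
  proof (rule finite_subset)
    show "?K (insert x S) n \<subseteq> ?i ` ?Sg" using j by (metis (no_types, lifting) image_eqI subsetI)
  qed (use fin in simp)
  ultimately show ?case by blast
qed

text \<open>Each product in the Leibniz formula takes one entry from every row, so the exponent can
  be attached to the row, independently of the permutation. Swapping the two sums gives numerical
  determinants.\<close>

lemma mfps_nth_det:
  fixes A :: "'k::finite \<Rightarrow> 'k \<Rightarrow> (complex, 'm::finite) mfps"
  shows "mfps_nth (det (\<chi> p q. A p q)) n
    = (\<Sum>k | sum k UNIV = n. det (\<chi> p q. mfps_nth (A p q) (k p)))"
proof -
  have "mfps_nth (det (\<chi> p q. A p q)) n
     = (\<Sum>s | s permutes UNIV. \<Sum>k | sum k UNIV = n. of_int (sign s) * (\<Prod>p\<in>UNIV. mfps_nth (A p (s p)) (k p)))"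
    by (simp add: det_def sum_distrib_left mfps_nth_prod[of UNIV])
  also have "\<dots> = (\<Sum>k | sum k UNIV = n. det (\<chi> p q. mfps_nth (A p q) (k p)))"
    by (subst sum.swap) (simp add: det_def)
  finally show ?thesis .
qed

lemma det_eq_0_if_left_null:
  fixes M :: "complex ^ 'n::finite ^ 'n"
  assumes "v v* M = 0" "v \<noteq> 0"
  shows "det M = 0"
proof (rule ccontr)
  assume "det M \<noteq> 0"
  then obtain M' where "M ** M' = mat 1"
    using invertible_det_nz[of M] by (auto simp: invertible_def)
  then have "v = v v* M v* M'"
    by (simp add: vector_matrix_mul_assoc)
  with assms show False by simp
qed

text \<open>For each permutation the two products agree: at fixed points the factors coincide, and
  the moved points are permuted among themselves, so their \<open>x\<close> have the same product.
  This exchanges \<open>s_p \<partial>_q\<close> for the Euler operator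
  \<open>s_q \<partial>_q\<close>.\<close>

lemma det_one_plus_rows_cols:
  fixes x :: "'n::finite \<Rightarrow> 'a::comm_ring_1"
  shows "det (\<chi> p q. (if p = q then 1 else 0) + x p * B p q)
    = det (\<chi> p q. (if p = q then 1 else 0) + x q * B p q)"
proof -
  have "(\<Prod>p\<in>UNIV. (if p = s p then 1 else 0) + x p * B p (s p))
      = (\<Prod>p\<in>UNIV. (if p = s p then 1 else 0) + x (s p) * B p (s p))"
    if s: "s permutes UNIV" for s :: "'n \<Rightarrow> 'n"
  proof -
    let ?N = "{p. s p \<noteq> p}"
    have split: "(\<Prod>p\<in>UNIV. (if p = s p then 1 else 0) + y p * B p (s p))
       = (\<Prod>p\<in>-?N. 1 + y p * B p p) * ((\<Prod>p\<in>?N. y p) * (\<Prod>p\<in>?N. B p (s p)))" for y :: "'n \<Rightarrow> 'a"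
    proof -
      have "(\<Prod>p\<in>UNIV. (if p = s p then 1 else 0) + y p * B p (s p))
        = (\<Prod>p\<in>-?N. (if p = s p then 1 else 0) + y p * B p (s p))
        * (\<Prod>p\<in>?N. (if p = s p then 1 else 0) + y p * B p (s p))"
        by (subst prod.union_disjoint[symmetric]) (auto intro!: prod.cong)
      then show ?thesis
        by (auto simp: prod.distrib[symmetric] intro!: arg_cong2[where f = "(*)"] prod.cong)
    qed
    have "(\<Prod>p\<in>?N. x (s p)) = (\<Prod>p\<in>?N. x p)"
    proof (rule prod.reindex_bij_betw)
      have inj: "inj s" and surj: "surj s" using s permutes_inj permutes_surj by blast+
      show "bij_betw s ?N ?N"
      proof (rule bij_betw_imageI)
        show "s ` ?N = ?N"
        proof (intro equalityI subsetI)
          fix y assume "y \<in> s ` ?N"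
          then show "y \<in> ?N" using injD[OF inj] by blast
        next
          fix y assume y: "y \<in> ?N"
          obtain x where "y = s x" using surj by (rule surjE)
          then show "y \<in> s ` ?N" using y by auto
        qed
      qed (rule inj_on_subset[OF inj subset_UNIV])
    qed
    then show ?thesis
    proof -
      have "(\<Prod>p\<in>-?N. 1 + x p * B p p) = (\<Prod>p\<in>-?N. 1 + x (s p) * B p p)"
        by (rule prod.cong) auto
      with \<open>(\<Prod>p\<in>?N. x (s p)) = (\<Prod>p\<in>?N. x p)\<close> show ?thesis
        by (simp only: split[of x] split[of "\<lambda>p. x (s p)"])
    qed
  qed
  then show ?thesis
    by (auto simp: det_def intro!: sum.cong)
qed

text \<open>The logarithmic Jacobian \<open>det (s_q \<partial>_q log (s_p exp \<Phi>_p))\<close> of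
  the substitution \<open>s_p \<mapsto> s_p exp \<Phi>_p\<close>.\<close>

definition lagrange_jac :: "('m::finite \<Rightarrow> (complex, 'm) mfps) \<Rightarrow> (complex, 'm) mfps" where
  "lagrange_jac \<Phi> = det (\<chi> p q. (if p = q then 1 else 0) + mfps_euler q (\<Phi> p))"

lemma lagrange_jac_eq:
  "det (\<chi> p q. (if p = q then 1 else 0) + mfps_var p * mfps_pderiv q (\<Phi> p)) = lagrange_jac \<Phi>"
  unfolding lagrange_jac_def mfps_var_times_pderiv[symmetric] by (rule det_one_plus_rows_cols)

definition vscale :: "nat ^ 'm::finite \<Rightarrow> ('m \<Rightarrow> (complex, 'm) mfps) \<Rightarrow> (complex, 'm) mfps" where
  "vscale n \<Phi> = (\<Sum>j\<in>UNIV. of_nat (n $ j) * \<Phi> j)"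

lemma vscale_add: "vscale (a + b) \<Phi> = vscale a \<Phi> + vscale b \<Phi>"
  by (simp add: vscale_def sum.distrib distrib_right)

text \<open>After an exponent shift this becomes the duality \<open>lagrange_coeff_basis\<close>.
  The exponential is distributed over the rows, one factor \<open>E p\<close> for each, before the
  determinant is expanded.\<close>

lemma mfps_nth_lagrange_jac_exp:
  "mfps_nth (lagrange_jac \<Phi> * mfps_exp (- vscale n \<Phi>)) n = (if n = 0 then 1 else 0)"
proof -
  define E where "E p = mfps_exp (- (of_nat (n $ p) * \<Phi> p))" for p
  define A where "A p q = E p * ((if p = q then 1 else 0) + mfps_euler q (\<Phi> p))" for p q
  have "lagrange_jac \<Phi> * mfps_exp (- vscale n \<Phi>) = prod E UNIV * lagrange_jac \<Phi>"
    by (simp add: vscale_def E_def sum_negf[symmetric] mfps_exp_sum mult.commute)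
  also have "\<dots> = det (\<chi> p q. A p q)"
  proof -
    have "(\<chi> p q. A p q) = (\<chi> p. E p *s (\<chi> q. (if p = q then 1 else 0) + mfps_euler q (\<Phi> p)))"
      by (simp add: vec_eq_iff A_def)
    then show ?thesis by (simp add: det_rows_mul lagrange_jac_def)
  qed
  finally have *: "mfps_nth (lagrange_jac \<Phi> * mfps_exp (- vscale n \<Phi>)) n
      = (\<Sum>k | sum k UNIV = n. det (\<chi> p q. mfps_nth (A p q) (k p)))"
    by (simp add: mfps_nth_det)
  have zero: "mfps_nth (A p q) k = (if p = q \<and> k = 0 then 1 else 0) + of_nat (k $ q) * mfps_nth (\<Phi> p) k"
    if "n $ p = 0" for p q k
    using that by (simp add: A_def E_def)
  \<comment> \<open>As \<open>E p\<close> is the exponential of \<open>- n_p \<Phi>_p\<close>, its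
    Euler derivative is \<open>- n_p E p\<close> times that of \<open>\<Phi>_p\<close>; this
    replaces derivatives of \<open>\<Phi>_p\<close> by the factor \<open>k_q\<close> on the
    coefficients of \<open>E p\<close>.\<close>
  have nonzero: "mfps_nth (A p q) k = mfps_nth (E p) k / of_nat (n $ p) * (of_nat (if p = q then n $ p else 0) - of_nat (k $ q))"
    if "n $ p \<noteq> 0" for p q k
  proof -
    have "of_nat (n $ p) * A p q = of_nat (if p = q then n $ p else 0) * E p - mfps_euler q (E p)"
    proof -
      have "mfps_euler q (E p) = - (of_nat (n $ p) * mfps_euler q (\<Phi> p) * E p)"
        by (simp add: E_def mfps_euler_exp mfps_euler_minus mfps_euler_of_nat_mult)
      then show ?thesis by (simp add: A_def distrib_left mult_ac)
    qed
    from arg_cong[OF this, of "\<lambda>F. mfps_nth F k"] that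
    show ?thesis
      by (simp only: mfps_nth_of_nat_mult mfps_nth_simps mfps_nth_euler) (simp add: field_simps)
  qed
  show ?thesis
  proof (cases "n = 0")
    case True
    then have K: "{k :: 'a \<Rightarrow> nat ^ 'a. sum k UNIV = n} = {\<lambda>_. 0}"
      by (auto simp: fun_eq_iff vec_eq_iff)
    have "(\<chi> p q. mfps_nth (A p q) 0) = mat 1"
      using True by (simp add: zero mat_def)
    then show ?thesis using True unfolding * K by simp
  next
    case False
    have "det (\<chi> p q. mfps_nth (A p q) (k p)) = 0" if k: "sum k UNIV = n" for k
    \<comment> \<open>In this case column \<open>p\<close> vanishes: the entries
      \<open>k p' $ p\<close> are natural numbers with sum \<open>n $ p = 0\<close>, and the
      Kronecker term on the diagonal is absent because \<open>k p \<noteq> 0\<close>.\<close>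
    proof (cases "\<exists>p. n $ p = 0 \<and> k p \<noteq> 0")
      case True
      then obtain p where p: "n $ p = 0" "k p \<noteq> 0" by blast
      have col: "k p' $ p = 0" for p'
      proof -
        have "(\<Sum>x\<in>UNIV. k x $ p) = 0"
          using arg_cong[OF k, of "\<lambda>v. v $ p"] p(1) by simp
        then show ?thesis by simp
      qed
      have "mfps_nth (A p' p) (k p') = 0" for p'
        using p col by (cases "n $ p' = 0") (auto simp: zero nonzero)
      then have "row p (transpose (\<chi> p q. mfps_nth (A p q) (k p))) = 0"
        by (simp add: row_def transpose_def vec_eq_iff)
      then have "det (transpose (\<chi> p q. mfps_nth (A p q) (k p))) = 0"
        by (rule det_zero_row)
      then show ?thesis by (simp only: det_transpose)
    next
      case False
      define c where "c p = (if n $ p = 0 then 1 else mfps_nth (E p) (k p) / of_nat (n $ p))" for p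
      define M :: "complex ^ 'a ^ 'a" where "M = (\<chi> p. \<chi> q. if n $ p = 0 then (if p = q then 1 else 0)
          else of_nat (if p = q then n $ p else 0) - of_nat (k p $ q))"
      have k0: "k p = 0" if "n $ p = 0" for p
        using False that by blast
      have "mfps_nth (A p q) (k p) = c p * M $ p $ q" for p q
        by (cases "n $ p = 0") (auto simp: k0 c_def M_def zero nonzero)
      then have "(\<chi> p q. mfps_nth (A p q) (k p)) = (\<chi> p. c p *s M $ p)"
        by (simp add: vec_eq_iff)
      then have "det (\<chi> p q. mfps_nth (A p q) (k p)) = prod c UNIV * det M"
        by (simp add: det_rows_mul)
      moreover have "det M = 0"
      proof (rule det_eq_0_if_left_null)
        \<comment> \<open>The null vector is the indicator of the support of \<open>n\<close>. Off
          the support \<open>k p = 0\<close>, so the supported rows of \<open>M\<close> sum to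
          \<open>n\<close> minus the sum of all \<open>k p\<close>, which is zero.\<close>
        show "(\<chi> p. if n $ p = 0 then 0 else 1) v* M = 0"
        proof -
          have "(\<Sum>p\<in>UNIV. M $ p $ q * (if n $ p = 0 then 0 else 1)) = 0" for q
          proof -
            have "(\<Sum>p\<in>UNIV. M $ p $ q * (if n $ p = 0 then 0 else 1))
               = (\<Sum>p\<in>UNIV. of_nat (if p = q then n $ p else 0) - of_nat (k p $ q))"
              by (intro sum.cong) (auto simp: M_def k0)
            also have "\<dots> = of_nat (n $ q) - of_nat ((sum k UNIV) $ q)"
              by (simp add: sum_subtractf flip: of_nat_sum)
            finally show ?thesis using k by simp
          qed
          then show ?thesis
            by (simp add: vector_matrix_mult_def vec_eq_iff mult.commute)
        qed
        show "(\<chi> p. if n $ p = 0 then 0 else 1) \<noteq> (0 :: complex ^ 'a)"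
          using \<open>n \<noteq> 0\<close> by (auto simp: vec_eq_iff)
      qed
      ultimately show ?thesis by simp
    qed
    then show ?thesis using False unfolding * by simp
  qed
qed

text \<open>
  The vanishing of \<open>K F\<close>, \<open>(K F)\<^sub>a = [s\<^sup>a] (J F exp (- a \<cdot> \<Phi>))\<close>, forces \<open>F = 0\<close> by looking at a nonzero
  coefficient of minimal degree; so the expansion in the series \<open>s\<^sup>a exp (a \<cdot> \<Phi>)\<close> need not be
  constructed recursively.
\<close>

definition lagrange_coeff :: "('m::finite \<Rightarrow> (complex, 'm) mfps) \<Rightarrow> (complex, 'm) mfps \<Rightarrow> nat ^ 'm \<Rightarrow> complex" where
  "lagrange_coeff \<Phi> F a = mfps_nth (lagrange_jac \<Phi> * F * mfps_exp (- vscale a \<Phi>)) a"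

text \<open>The image of the monomial \<open>s^a\<close> under the substitution
  \<open>s_i \<mapsto> s_i exp \<Phi>_i\<close>.\<close>

definition lagrange_basis :: "('m::finite \<Rightarrow> (complex, 'm) mfps) \<Rightarrow> nat ^ 'm \<Rightarrow> (complex, 'm) mfps" where
  "lagrange_basis \<Phi> a = mfps_monom a * mfps_exp (vscale a \<Phi>)"

lemma lagrange_basis_eq_0:
  assumes "\<not> (\<forall>i. a $ i \<le> n $ i)"
  shows "mfps_nth (lagrange_basis \<Phi> a) n = 0"
  unfolding lagrange_basis_def
  by (rule mfps_nth_monom_times_eq_0) (use assms in auto)

text \<open>If \<open>a = b + c\<close>, the factor \<open>s^b\<close> cancels and the exponentials
  combine to exponent \<open>- c\<close>, leaving \<open>mfps_nth_lagrange_jac_exp\<close> at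
  \<open>c\<close>. Otherwise \<open>s^b\<close> does not divide \<open>s^a\<close> and the
  coefficient is zero.\<close>

lemma lagrange_coeff_basis: "lagrange_coeff \<Phi> (lagrange_basis \<Phi> b) a = (if a = b then 1 else 0)"
proof (cases "\<exists>c. a = b + c")
  case True
  then obtain c where c: "a = b + c" by blast
  have "mfps_exp (vscale b \<Phi>) * mfps_exp (- vscale a \<Phi>) = mfps_exp (- vscale c \<Phi>)"
    by (simp add: mfps_exp_add[symmetric] c vscale_add)
  then have "lagrange_jac \<Phi> * lagrange_basis \<Phi> b * mfps_exp (- vscale a \<Phi>)
      = mfps_monom b * (lagrange_jac \<Phi> * mfps_exp (- vscale c \<Phi>))"
    by (metis (no_types, lifting) lagrange_basis_def mult.assoc mult.left_commute)
  then show ?thesis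
    by (simp add: lagrange_coeff_def c mfps_nth_monom_times_add mfps_nth_lagrange_jac_exp)
next
  case False
  then have "mfps_nth (mfps_monom b * (lagrange_jac \<Phi> * mfps_exp (vscale b \<Phi>) * mfps_exp (- vscale a \<Phi>))) a = 0"
    by (intro mfps_nth_monom_times_eq_0) blast
  moreover have "a \<noteq> b" using False by (metis add_0_right)
  ultimately show ?thesis
    by (simp add: lagrange_coeff_def lagrange_basis_def mult_ac)
qed

text \<open>Used to truncate an infinite expansion to finitely many terms before applying
  linearity.\<close>

lemma lagrange_coeff_cong:
  assumes "\<And>p. (\<forall>i. p $ i \<le> a $ i) \<Longrightarrow> mfps_nth F p = mfps_nth H p"
  shows "lagrange_coeff \<Phi> F a = lagrange_coeff \<Phi> H a"
proof -
  have "mfps_nth (F * (lagrange_jac \<Phi> * mfps_exp (- vscale a \<Phi>))) a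
      = mfps_nth (H * (lagrange_jac \<Phi> * mfps_exp (- vscale a \<Phi>))) a"
    unfolding mfps_nth_times[of F] mfps_nth_times[of H]
    by (rule sum.cong) (auto simp: assms)
  then show ?thesis by (simp add: lagrange_coeff_def mult_ac)
qed

lemma lagrange_coeff_diff: "lagrange_coeff \<Phi> (F - H) a = lagrange_coeff \<Phi> F a - lagrange_coeff \<Phi> H a"
  by (simp add: lagrange_coeff_def algebra_simps)

lemma lagrange_coeff_sum:
  "lagrange_coeff \<Phi> (\<Sum>b\<in>S. Abs_mfps (\<lambda>n. c b * mfps_nth (f b) n)) a = (\<Sum>b\<in>S. c b * lagrange_coeff \<Phi> (f b) a)"
proof -
  have *: "mfps_nth (Abs_mfps (\<lambda>n. c * mfps_nth f n) * H) a = c * mfps_nth (f * H) a" for c f H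
    by (simp add: mfps_nth_times sum_distrib_left case_prod_beta mult.assoc)
  show ?thesis
    by (simp add: lagrange_coeff_def mult.commute[of "lagrange_jac \<Phi>"] mult.assoc sum_distrib_right *)
qed

lemma lagrange_coeff_inject:
  assumes "\<And>a. lagrange_coeff \<Phi> F a = 0"
  shows "F = 0"
proof -
  have "mfps_nth F n = 0" for n
  proof (induction "vdeg n" arbitrary: n rule: less_induct)
    case less
    let ?H = "lagrange_jac \<Phi> * mfps_exp (- vscale n \<Phi>)"
    have "0 = mfps_nth (F * ?H) n"
      using assms[of n] by (simp add: lagrange_coeff_def mult_ac)
    \<comment> \<open>In every other split the coefficient of \<open>F\<close> has lower degree and
      vanishes by induction.\<close>
    also have "\<dots> = (\<Sum>(p, q)\<in>{(n, 0)}. mfps_nth F p * mfps_nth ?H q)"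
      unfolding mfps_nth_times[of F]
    proof (rule sum.mono_neutral_right)
      show "\<forall>x\<in>{(p, q). p + q = n} - {(n, 0)}. (case x of (p, q) \<Rightarrow> mfps_nth F p * mfps_nth ?H q) = 0"
      proof
        fix x assume x: "x \<in> {(p, q). p + q = n} - {(n, 0)}"
        have "snd x \<noteq> 0"
        proof
          assume "snd x = 0"
          with x show False by (cases x) auto
        qed
        then have "vdeg (fst x) < vdeg n"
          using x vdeg_eq_0_iff[of "snd x"] by (auto simp: vdeg_add)
        then show "(case x of (p, q) \<Rightarrow> mfps_nth F p * mfps_nth ?H q) = 0"
          using less by (simp add: split_def)
      qed
    qed (auto simp: finite_vec_nat_splits)
    also have "\<dots> = mfps_nth F n * (mfps_nth (lagrange_jac \<Phi>) 0 * exp (- mfps_nth (vscale n \<Phi>) 0))"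
      by (simp add: mfps_nth_exp_0)
    also have "mfps_nth (lagrange_jac \<Phi>) 0 = 1"
      using mfps_nth_lagrange_jac_exp[of \<Phi> 0] by (simp add: vscale_def)
    finally show ?case by simp
  qed
  then show ?thesis by (auto intro: mfps_eqI)
qed

text \<open>The basis series at \<open>a\<close> only involves exponents above \<open>a\<close>, so
  the infinite combination is finite in each coefficient, and duality reads off \<open>c\<close>.
  Besides the expansion theorem, this yields injectivity of \<open>X\<close>.\<close>

lemma lagrange_coeff_series:
  "lagrange_coeff \<Phi> (Abs_mfps (\<lambda>n. \<Sum>a | \<forall>i. a $ i \<le> n $ i. c a * mfps_nth (lagrange_basis \<Phi> a) n)) b = c b"
proof -
  let ?B = "{a. \<forall>i. a $ i \<le> b $ i}"
  let ?P = "Abs_mfps (\<lambda>n. \<Sum>a | \<forall>i. a $ i \<le> n $ i. c a * mfps_nth (lagrange_basis \<Phi> a) n)"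
  have "lagrange_coeff \<Phi> ?P b
      = lagrange_coeff \<Phi> (\<Sum>a\<in>?B. Abs_mfps (\<lambda>n. c a * mfps_nth (lagrange_basis \<Phi> a) n)) b"
  proof (rule lagrange_coeff_cong)
    fix p :: "nat ^ 'a" assume p: "\<forall>i. p $ i \<le> b $ i"
    show "mfps_nth ?P p = mfps_nth (\<Sum>a\<in>?B. Abs_mfps (\<lambda>n. c a * mfps_nth (lagrange_basis \<Phi> a) n)) p"
      unfolding mfps_nth_sum mfps_nth_Abs
    proof (rule sum.mono_neutral_left)
      show "{a. \<forall>i. a $ i \<le> p $ i} \<subseteq> ?B" using p order.trans by blast
    qed (auto simp: finite_vec_nat_le lagrange_basis_eq_0)
  qed
  also have "\<dots> = (\<Sum>a\<in>?B. if a = b then c a else 0)"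
    unfolding lagrange_coeff_sum lagrange_coeff_basis by (rule sum.cong) auto
  also have "\<dots> = c b"
    by (simp add: finite_vec_nat_le)
  finally show ?thesis .
qed

text \<open>By duality, \<open>F\<close> and its proposed expansion have the same Lagrange
  coefficients, and these determine a series.\<close>

theorem lagrange_expansion:
  "mfps_nth F n = (\<Sum>a | \<forall>i. a $ i \<le> n $ i. lagrange_coeff \<Phi> F a * mfps_nth (lagrange_basis \<Phi> a) n)"
proof -
  define P where "P = Abs_mfps (\<lambda>n. \<Sum>a | \<forall>i. a $ i \<le> n $ i. lagrange_coeff \<Phi> F a * mfps_nth (lagrange_basis \<Phi> a) n)"
  have "F - P = 0"
    by (rule lagrange_coeff_inject[of \<Phi>]) (simp add: lagrange_coeff_diff P_def lagrange_coeff_series)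
  then have "F = P" by simp
  from arg_cong[OF this, of "\<lambda>f. mfps_nth f n"] show ?thesis
    by (simp only: P_def mfps_nth_Abs)
qed


section \<open>The cone of the lattice\<close>

lemma zsmul_of_nat: "zsmul (int n) x = (\<Sum>k<n. x)"
  by (simp add: zsmul_def)

lemma zsmul_plus_1: "zsmul (a + 1) x = zsmul a x + x"
proof -
  consider "0 \<le> a" | "a = -1" | "a < -1" by linarith
  then show ?thesis
  proof cases
    case 1
    then have "nat (a + 1) = Suc (nat a)" by simp
    with 1 show ?thesis by (simp add: zsmul_def add.commute)
  next
    case 3
    then have "nat (- a) = Suc (nat (- (a + 1)))" by simp
    with 3 show ?thesis by (simp add: zsmul_def del: minus_add_distrib)
  qed (simp add: zsmul_def)
qed

lemma zsmul_minus_1: "zsmul (a - 1) x = zsmul a x - x"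
  using zsmul_plus_1[of "a - 1" x] by simp

lemma zsmul_add: "zsmul (a + b) x = zsmul a x + zsmul b x"
proof (induction b rule: int_induct[where k = 0])
  case base
  show ?case by (simp add: zsmul_def)
next
  case (step1 i)
  then show ?case using zsmul_plus_1[of "a + i" x] by (simp add: zsmul_plus_1 add.assoc)
next
  case (step2 i)
  then show ?case using zsmul_minus_1[of "a + i" x] by (simp add: zsmul_minus_1 add_diff_eq)
qed

lemma additive_zsmul:
  fixes h :: "'g::ab_group_add \<Rightarrow> 'b::comm_ring_1"
  assumes add: "\<And>x y. h (x + y) = h x + h y"
  shows "h (zsmul a x) = of_int a * h x"
proof -
  have h0: "h 0 = 0" using add[of 0 0] by simp
  have hd: "h (x - y) = h x - h y" for x y using add[of "x - y" y] by simp
  show ?thesis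
  proof (induction a rule: int_induct[where k = 0])
    case base
    show ?case by (simp add: zsmul_def h0)
  qed (simp_all add: zsmul_plus_1 zsmul_minus_1 add hd algebra_simps)
qed

lemma additive_lat_point:
  fixes h :: "'g::ab_group_add \<Rightarrow> 'b::comm_ring_1"
  assumes add: "\<And>x y. h (x + y) = h x + h y"
  shows "h (lat_point D c) = (\<Sum>i\<in>UNIV. of_int (c $ i) * h (basis D i))"
proof -
  have "h (\<Sum>i\<in>S. zsmul (c $ i) (basis D i)) = (\<Sum>i\<in>S. of_int (c $ i) * h (basis D i))" if "finite S" for S
    using that add[of 0 0] by (induction S rule: finite_induct) (auto simp: add additive_zsmul)
  then show ?thesis by (simp add: lat_point_def)
qed

definition cone_point :: "('g::ab_group_add, 'm::finite) stab \<Rightarrow> nat ^ 'm \<Rightarrow> 'g" where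
  "cone_point D n = lat_point D (\<chi> i. int (n $ i))"

lemma lat_point_add: "lat_point D (c + d) = lat_point D c + lat_point D d"
  by (simp add: lat_point_def zsmul_add sum.distrib)

lemma cone_point_add: "cone_point D (m + n) = cone_point D m + cone_point D n"
proof -
  have "(\<chi> i. int ((m + n) $ i)) = (\<chi> i. int (m $ i)) + (\<chi> i. int (n $ i))"
    by (simp add: vec_eq_iff)
  then show ?thesis by (simp add: cone_point_def lat_point_add)
qed

lemma cone_point_0 [simp]: "cone_point D 0 = 0"
  using cone_point_add[of D 0 0] by simp

lemma mfps_nth_to_mfps: "mfps_nth (to_mfps D f) n = f (cone_point D n)"
  by (simp add: to_mfps_def cone_point_def)

lemma lat_point_axis: "lat_point D (axis p 1) = basis D p"
proof -
  have "lat_point D (axis p 1) = (\<Sum>i\<in>UNIV. if i = p then basis D i else 0)"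
    unfolding lat_point_def by (rule sum.cong) (auto simp: zsmul_def axis_def)
  then show ?thesis by simp
qed

lemma cone_point_axis: "cone_point D (axis p 1) = basis D p"
proof -
  have "(\<chi> i. int (axis p 1 $ i)) = axis p 1" by (simp add: vec_eq_iff axis_def)
  then show ?thesis by (simp add: cone_point_def lat_point_axis)
qed

context positive_generic_stability
begin

lemma coords_lat_point: "coords D (lat_point D c) = c"
  using basis by (simp add: coords_def bij_is_inj)

lemma lat_point_coords: "lat_point D (coords D x) = x"
  using basis by (simp add: coords_def bij_is_surj surj_f_inv_f)

lemma additive_coords:
  fixes h :: "'g \<Rightarrow> 'b::comm_ring_1"
  assumes "\<And>x y. h (x + y) = h x + h y"
  shows "h x = (\<Sum>i\<in>UNIV. of_int (coords D x $ i) * h (basis D i))"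
  using additive_lat_point[of h D "coords D x"] assms by (simp add: lat_point_coords)

lemma coords_basis: "coords D (basis D p) = axis p 1"
  using coords_lat_point[of "axis p 1"] by (simp add: lat_point_axis)

lemma coords_0: "coords D 0 = 0"
  using coords_lat_point[of 0] by (simp add: lat_point_def zsmul_def)

lemma coords_cone_point: "coords D (cone_point D n) $ i = int (n $ i)"
  by (simp add: cone_point_def coords_lat_point)

lemma exponent_cone_point [simp]: "exponent D (cone_point D n) = n"
  by (simp add: exponent_def coords_cone_point vec_eq_iff)

lemma cone_point_in_cone [simp]: "cone_point D n \<in> pos_cone D"
proof -
  have *: "(\<Sum>k<j. basis D i) \<in> pos_cone D" for i and j :: nat
    by (induction j) (auto simp: cone_zero cone_add basis_in_cone)
  have "(\<Sum>i\<in>S. zsmul (int (n $ i)) (basis D i)) \<in> pos_cone D" if "finite S" for S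
    using that by (induction S rule: finite_induct) (auto simp: zsmul_of_nat cone_zero cone_add *)
  then show ?thesis by (simp add: cone_point_def lat_point_def)
qed

lemma cone_point_exponent: "x \<in> pos_cone D \<Longrightarrow> cone_point D (exponent D x) = x"
proof -
  assume x: "x \<in> pos_cone D"
  then have "(\<chi> i. int (exponent D x $ i)) = coords D x"
    using cone_coords_nonneg by (simp add: vec_eq_iff exponent_def)
  then show ?thesis by (simp add: cone_point_def lat_point_coords)
qed

lemma pos_cone_eq: "pos_cone D = range (cone_point D)"
  using cone_point_exponent by (auto intro: range_eqI[OF sym])

lemma inj_cone_point: "inj (cone_point D)"
  by (metis exponent_cone_point injI)

lemma cone_point_eq_iff [simp]: "cone_point D m = cone_point D n \<longleftrightarrow> m = n"
  using inj_cone_point by (simp add: inj_eq)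

lemma cone_point_eq_0_iff [simp]: "cone_point D m = 0 \<longleftrightarrow> m = 0"
  using cone_point_eq_iff[of m 0] by (simp del: cone_point_eq_iff)

lemma exponent_add: "x \<in> pos_cone D \<Longrightarrow> y \<in> pos_cone D \<Longrightarrow> exponent D (x + y) = exponent D x + exponent D y"
  by (auto simp: pos_cone_eq cone_point_add[symmetric])

lemma exponent_eq_0_iff: "x \<in> pos_cone D \<Longrightarrow> exponent D x = 0 \<longleftrightarrow> x = 0"
  using cone_point_exponent[of x] exponent_cone_point[of 0] by auto

section \<open>The completed algebra as a power series ring\<close>

lemma cone_splits:
  "{(\<beta>, \<delta>). \<beta> \<in> pos_cone D \<and> \<delta> \<in> pos_cone D \<and> \<beta> + \<delta> = cone_point D n}
     = map_prod (cone_point D) (cone_point D) ` {(p, q). p + q = n}"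
  by (auto simp: pos_cone_eq cone_point_add[symmetric] image_iff)

lemma finite_cone_splits: "finite {(\<beta>, \<delta>). \<beta> \<in> pos_cone D \<and> \<delta> \<in> pos_cone D \<and> \<beta> + \<delta> = \<gamma>}"
proof (cases "\<gamma> \<in> pos_cone D")
  case True
  then obtain n where "\<gamma> = cone_point D n" by (auto simp: pos_cone_eq)
  then show ?thesis by (simp only: cone_splits finite_imageI[OF finite_vec_nat_splits])
next
  case False
  then have "{(\<beta>, \<delta>). \<beta> \<in> pos_cone D \<and> \<delta> \<in> pos_cone D \<and> \<beta> + \<delta> = \<gamma>} = {}"
    using cone_add by auto
  then show ?thesis by (simp only: finite.emptyI)
qed

lemma hmult_cone_point:
  "hmult D f g (cone_point D n) = (\<Sum>(p, q)\<in>{(p, q). p + q = n}. f (cone_point D p) * g (cone_point D q))"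
  unfolding hmult_def cone_splits
  by (subst sum.reindex) (auto simp: inj_on_def case_prod_beta)

lemma to_mfps_hmult: "to_mfps D (hmult D f g) = to_mfps D f * to_mfps D g"
  by (rule mfps_eqI) (simp add: mfps_nth_to_mfps mfps_nth_times hmult_cone_point)

lemma hmult_outside: "\<gamma> \<notin> pos_cone D \<Longrightarrow> hmult D f g \<gamma> = 0"
  using cone_add by (auto simp: hmult_def intro!: sum.neutral)

lemma to_mfps_gen: "to_mfps D (gen (cone_point D a)) = mfps_monom a"
  by (rule mfps_eqI) (simp add: mfps_nth_to_mfps gen_def mfps_monom_def)

lemma to_mfps_gen_0: "to_mfps D (gen 0) = 1"
  by (rule mfps_eqI) (simp add: mfps_nth_to_mfps gen_def)

lemma to_mfps_hprod: "to_mfps D (hprod D (replicate k f)) = to_mfps D f ^ k"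
  by (induction k) (auto simp: hprod_def to_mfps_gen_0 to_mfps_hmult)

text \<open>Both exponentials are defined coefficientwise by the same series, so compatibility with
  powers is enough.\<close>

lemma to_mfps_hexp: "to_mfps D (hexp D f) = mfps_exp (to_mfps D f)"
  by (rule mfps_eqI)
     (simp add: mfps_exp_def to_mfps_hprod[symmetric] mfps_nth_to_mfps hexp_def)

lemma ghat_eqI:
  assumes "f \<in> ghat D" "g \<in> ghat D" "to_mfps D f = to_mfps D g"
  shows "f = g"
proof
  fix \<gamma>
  show "f \<gamma> = g \<gamma>"
  proof (cases "\<gamma> \<in> pos_cone D")
    case True
    then obtain n where "\<gamma> = cone_point D n" by (auto simp: pos_cone_eq)
    then show ?thesis
      using arg_cong[OF assms(3), of "\<lambda>F. mfps_nth F n"] by (simp add: mfps_nth_to_mfps)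
  qed (use assms in \<open>auto simp: ghat_def\<close>)
qed

lemma gen_in_ghat: "\<gamma> \<in> pos_cone D \<Longrightarrow> gen \<gamma> \<in> ghat D"
  by (auto simp: ghat_def gen_def)

lemma hmult_gen_gen:
  assumes "a \<in> pos_cone D" "b \<in> pos_cone D"
  shows "hmult D (\<lambda>\<eta>. c * gen a \<eta>) (\<lambda>\<eta>. d * gen b \<eta>) = (\<lambda>\<eta>. (c * d) * gen (a + b) \<eta>)"
proof
  fix \<gamma>
  let ?S = "{(\<beta>, \<delta>). \<beta> \<in> pos_cone D \<and> \<delta> \<in> pos_cone D \<and> \<beta> + \<delta> = \<gamma>}"
  have "hmult D (\<lambda>\<eta>. c * gen a \<eta>) (\<lambda>\<eta>. d * gen b \<eta>) \<gamma>
     = (\<Sum>x\<in>?S. if x = (a, b) then c * d else 0)"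
    unfolding hmult_def by (rule sum.cong) (auto simp: gen_def split: if_splits)
  also have "\<dots> = (c * d) * gen (a + b) \<gamma>"
    using assms by (auto simp: gen_def finite_cone_splits)
  finally show "hmult D (\<lambda>\<eta>. c * gen a \<eta>) (\<lambda>\<eta>. d * gen b \<eta>) \<gamma> = (c * d) * gen (a + b) \<gamma>" .
qed

end


section \<open>Trees\<close>

text \<open>The degree in which \<open>G\<close> of a tree is concentrated, see
  \<open>G_eq_gval\<close>.\<close>

primrec tree_total :: "'g::ab_group_add dec_tree \<Rightarrow> 'g" where
  "tree_total (Node g ts) = g + sum_list (map tree_total ts)"

text \<open>A vertex and its parent never share a ray, so the nested integrals have no poles on the
  path of integration.\<close>

fun tree_good :: "('g::ab_group_add, 'm) stab \<Rightarrow> 'g dec_tree \<Rightarrow> bool" where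
  "tree_good D (Node g ts) \<longleftrightarrow> DT D g \<noteq> 0 \<and> g \<noteq> 0 \<and>
     (\<forall>T\<in>set ts. tree_good D T \<and> pairing D (root_dec T) g \<noteq> 0)"

lemma finite_tree_verts: "finite (tree_verts T)"
proof (induction T)
  case (Node g ts)
  have "tree_verts (Node g ts) = insert [] (\<Union>i<length ts. (#) i ` tree_verts (ts ! i))"
    by auto
  then show ?case using Node by simp
qed

lemma finite_tree_edges: "finite (tree_edges T)"
  by (rule finite_subset[of _ "tree_verts T \<times> tree_verts T"])
     (auto simp: tree_edges_def finite_tree_verts)

lemma Nil_in_tree_verts [simp]: "[] \<in> tree_verts T"
  by (cases T) simp

lemma Cons_in_tree_verts [simp]:
  "i # v \<in> tree_verts (Node g ts) \<longleftrightarrow> i < length ts \<and> v \<in> tree_verts (ts ! i)"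
  by auto

lemma tree_edges_child: "i < length ts \<Longrightarrow> ([i], []) \<in> tree_edges (Node g ts)"
  unfolding tree_edges_def by (simp del: tree_verts.simps)

lemma tree_edges_lift:
  "i < length ts \<Longrightarrow> (v, w) \<in> tree_edges (ts ! i) \<Longrightarrow> (i # v, i # w) \<in> tree_edges (Node g ts)"
  unfolding tree_edges_def by (simp del: tree_verts.simps)

text \<open>Every vertex except the root is the source of an edge, so conditions on edges together
  with conditions on the root reach all vertices. Edges of a branch lift to edges of the whole
  tree.\<close>

lemma tree_good_if_edges:
  assumes "\<And>v w. (v, w) \<in> tree_edges T \<Longrightarrow>
      DT D (tree_dec T v) \<noteq> 0 \<and> tree_dec T v \<noteq> 0 \<and> pairing D (tree_dec T v) (tree_dec T w) \<noteq> 0"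
    and "DT D (root_dec T) \<noteq> 0" "root_dec T \<noteq> 0"
  shows "tree_good D T"
  using assms
proof (induction T)
  case (Node g ts)
  have "tree_good D T \<and> pairing D (root_dec T) g \<noteq> 0" if T: "T \<in> set ts" for T
  proof -
    from T obtain i where i: "i < length ts" "T = ts ! i" by (auto simp: in_set_conv_nth)
    have e: "DT D (root_dec T) \<noteq> 0" "root_dec T \<noteq> 0" "pairing D (root_dec T) g \<noteq> 0"
      using Node.prems(1)[OF tree_edges_child[OF i(1)]] i(2) by simp_all
    have "tree_good D T"
    proof (rule Node.IH[OF T])
      fix v w assume "(v, w) \<in> tree_edges T"
      then have "(i # v, i # w) \<in> tree_edges (Node g ts)" unfolding i(2) by (rule tree_edges_lift[OF i(1)])
      from Node.prems(1)[OF this]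
      show "DT D (tree_dec T v) \<noteq> 0 \<and> tree_dec T v \<noteq> 0 \<and> pairing D (tree_dec T v) (tree_dec T w) \<noteq> 0"
        using i by simp
    qed (rule e)+
    then show ?thesis using e by simp
  qed
  then show ?case using Node.prems(2,3) by simp
qed

context positive_generic_stability
begin

section \<open>Weights of trees\<close>

lemma pairing_rat_rat_coords: "pairing_rat D (rat_coords D x) (rat_coords D y) = of_int (pairing D x y)"
proof -
  have "(of_int (pairing D x y) :: rat)
     = (\<Sum>i\<in>UNIV. of_int (coords D x $ i) * of_int (pairing D (basis D i) y))"
    using additive_coords[of "\<lambda>x. of_int (pairing D x y)" x] by (simp add: pairing_add_left)
  also have "\<dots> = (\<Sum>i\<in>UNIV. of_int (coords D x $ i) *
        (\<Sum>j\<in>UNIV. of_int (coords D y $ j) * of_int (pairing D (basis D i) (basis D j))))"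
  proof -
    have "(of_int (pairing D u y) :: rat)
        = (\<Sum>j\<in>UNIV. of_int (coords D y $ j) * of_int (pairing D u (basis D j)))" for u
      using additive_coords[of "\<lambda>y. of_int (pairing D u y)" y] by (simp add: pairing_add_right)
    then show ?thesis by simp
  qed
  finally show ?thesis
    by (simp add: pairing_rat_def rat_coords_def sum_distrib_left mult.assoc)
qed

lemma pairing_rat_scale: "pairing_rat D (c *s v) w = c * pairing_rat D v w"
  by (simp add: pairing_rat_def sum_distrib_left mult.assoc)

lemma pairing_rat_zero_right: "pairing_rat D v 0 = 0"
  by (simp add: pairing_rat_def)

lemma pairing_rat_coords:
  "pairing_rat D (rat_coords D x) w
     = (\<Sum>j\<in>UNIV. of_int (coords D x $ j) * pairing_rat D (rat_coords D (basis D j)) w)"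
proof -
  have "pairing_rat D (rat_coords D (basis D k)) w
      = (\<Sum>j\<in>UNIV. w $ j * of_int (pairing D (basis D k) (basis D j)))" for k
  proof -
    have "pairing_rat D (rat_coords D (basis D k)) w
       = (\<Sum>i\<in>UNIV. if i = k then \<Sum>j\<in>UNIV. w $ j * of_int (pairing D (basis D k) (basis D j)) else 0)"
      unfolding pairing_rat_def
      by (rule sum.cong) (auto simp: rat_coords_def coords_basis axis_def)
    then show ?thesis by simp
  qed
  then show ?thesis
    by (simp add: pairing_rat_def rat_coords_def sum_distrib_left mult.assoc)
qed

lemma rat_coords_0: "rat_coords D 0 = 0"
  by (simp add: rat_coords_def coords_0 vec_eq_iff)

lemma pairing_zero_left: "pairing D 0 y = 0"
  using pairing_add_left[of 0 0 y] by simp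

text \<open>All factors of a nonzero weight are nonzero: the root factor controls the root, and the
  factor of an edge controls its source and the pairing with the parent.\<close>

lemma tree_good_if_weight:
  assumes "W D T \<noteq> 0"
  shows "tree_good D T"
proof (rule tree_good_if_edges)
  show "DT D (root_dec T) \<noteq> 0"
    using assms by (auto simp: W_def)
  show "root_dec T \<noteq> 0"
    using assms by (auto simp: W_def rat_coords_0)
  fix v w assume e: "(v, w) \<in> tree_edges T"
  have "(\<Prod>(v, w)\<in>tree_edges T.
      pairing_rat D (DT D (tree_dec T v) *s rat_coords D (tree_dec T v)) (rat_coords D (tree_dec T w))) \<noteq> 0"
    using assms by (auto simp: W_def)
  then have "DT D (tree_dec T v) * of_int (pairing D (tree_dec T v) (tree_dec T w)) \<noteq> 0"
    using e by (auto simp: finite_tree_edges pairing_rat_scale pairing_rat_rat_coords)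
  then show "DT D (tree_dec T v) \<noteq> 0 \<and> tree_dec T v \<noteq> 0 \<and> pairing D (tree_dec T v) (tree_dec T w) \<noteq> 0"
    using pairing_zero_left by auto
qed

section \<open>Degrees in the cone and finiteness of the set of good trees\<close>

lemma sum_list_in_cone: "(\<And>x. x \<in> set xs \<Longrightarrow> x \<in> pos_cone D) \<Longrightarrow> sum_list xs \<in> pos_cone D"
  by (induction xs) (auto simp: cone_zero cone_add)

lemma tree_total_in_cone: "tree_good D T \<Longrightarrow> tree_total T \<in> pos_cone D"
proof (induction T)
  case (Node g ts)
  then show ?case by (auto intro!: cone_add positive[of g] sum_list_in_cone)
qed

definition cone_deg :: "'g \<Rightarrow> nat" where
  "cone_deg x = vdeg (exponent D x)"

lemma cone_deg_add: "x \<in> pos_cone D \<Longrightarrow> y \<in> pos_cone D \<Longrightarrow> cone_deg (x + y) = cone_deg x + cone_deg y"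
  by (simp add: cone_deg_def exponent_add vdeg_add)

lemma cone_deg_pos: "x \<in> pos_cone D \<Longrightarrow> x \<noteq> 0 \<Longrightarrow> 0 < cone_deg x"
  by (metis cone_deg_def exponent_eq_0_iff vdeg_eq_0_iff gr0I)

lemma cone_deg_sum_list:
  "(\<And>x. x \<in> set xs \<Longrightarrow> x \<in> pos_cone D) \<Longrightarrow> cone_deg (sum_list xs) = sum_list (map cone_deg xs)"
proof (induction xs)
  case Nil
  have "cone_deg 0 = 0" using exponent_eq_0_iff[of 0] by (simp add: cone_deg_def cone_zero vdeg_eq_0_iff)
  then show ?case by simp
qed (simp add: cone_deg_add sum_list_in_cone)

lemma finite_cone_deg_le: "finite {x \<in> pos_cone D. cone_deg x \<le> N}"
proof (rule finite_subset)
  show "{x \<in> pos_cone D. cone_deg x \<le> N} \<subseteq> cone_point D ` {p. \<forall>i. p $ i \<le> (\<chi> i. N) $ i}"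
  proof safe
    fix x assume x: "x \<in> pos_cone D" "cone_deg x \<le> N"
    have "exponent D x $ i \<le> vdeg (exponent D x)" for i
      unfolding vdeg_def by (rule member_le_sum) auto
    then show "x \<in> cone_point D ` {p. \<forall>i. p $ i \<le> (\<chi> i. N) $ i}"
      using x cone_point_exponent[of x, symmetric] by (auto simp: cone_deg_def intro: order.trans)
  qed
qed (use finite_vec_nat_le in blast)

lemma tree_total_ne_0: "tree_good D T \<Longrightarrow> 0 < cone_deg (tree_total T)"
proof (induction T)
  case (Node g ts)
  have "cone_deg (tree_total (Node g ts)) = cone_deg g + cone_deg (sum_list (map tree_total ts))"
    using Node.prems by (auto intro!: cone_deg_add positive[of g] sum_list_in_cone tree_total_in_cone)
  then show ?case using Node.prems cone_deg_pos[OF positive] by auto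
qed

text \<open>A good root has positive degree, so the branches fall under the induction hypothesis.
  Each branch has positive degree as well, which bounds their number, and the cone has finitely many
  elements of bounded degree for the root.\<close>

lemma finite_good_trees_deg_le: "finite {T. tree_good D T \<and> cone_deg (tree_total T) \<le> N}"
proof (induction N)
  case 0
  have "{T. tree_good D T \<and> cone_deg (tree_total T) \<le> 0} = {}"
    using tree_total_ne_0 by fastforce
  then show ?case by (metis finite.emptyI)
next
  case (Suc N)
  let ?S = "{T. tree_good D T \<and> cone_deg (tree_total T) \<le> N}"
  let ?A = "{x \<in> pos_cone D. cone_deg x \<le> Suc N} \<times> {ts. set ts \<subseteq> ?S \<and> length ts \<le> Suc N}"
  have "{T. tree_good D T \<and> cone_deg (tree_total T) \<le> Suc N} \<subseteq> (\<lambda>(g, ts). Node g ts) ` ?A"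
  proof
    fix T assume T: "T \<in> {T. tree_good D T \<and> cone_deg (tree_total T) \<le> Suc N}"
    obtain g ts where T_eq: "T = Node g ts" by (cases T)
    have g: "g \<in> pos_cone D" "0 < cone_deg g"
      using T T_eq by (auto simp: positive cone_deg_pos)
    have good: "tree_good D U" if "U \<in> set ts" for U using T T_eq that by auto
    have "cone_deg (tree_total T) = cone_deg g + cone_deg (sum_list (map tree_total ts))"
      using g good by (auto simp: T_eq intro!: cone_deg_add sum_list_in_cone tree_total_in_cone)
    also have "cone_deg (sum_list (map tree_total ts)) = (\<Sum>U\<leftarrow>ts. cone_deg (tree_total U))"
      using good by (subst cone_deg_sum_list) (auto intro: tree_total_in_cone simp: comp_def)
    finally have sum: "cone_deg g + (\<Sum>U\<leftarrow>ts. cone_deg (tree_total U)) \<le> Suc N" using T by simp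
    have "cone_deg (tree_total U) \<le> N" if "U \<in> set ts" for U
    proof -
      have "cone_deg (tree_total U) \<le> (\<Sum>U\<leftarrow>ts. cone_deg (tree_total U))"
        using that by (intro member_le_sum_list) auto
      then show ?thesis using sum g by linarith
    qed
    moreover have "length ts \<le> Suc N"
    proof -
      have "length ts = (\<Sum>U\<leftarrow>ts. 1)" by (simp add: sum_list_triv)
      also have "\<dots> \<le> (\<Sum>U\<leftarrow>ts. cone_deg (tree_total U))"
        using good by (intro sum_list_mono) (use tree_total_ne_0 in \<open>fastforce simp: Suc_le_eq\<close>)
      finally show ?thesis using sum by linarith
    qed
    ultimately have "(g, ts) \<in> ?A" using g good sum by auto
    then show "T \<in> (\<lambda>(g, ts). Node g ts) ` ?A" using T_eq by force
  qed
  moreover have "finite ?A"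
    using finite_lists_length_le[OF Suc.IH] finite_cone_deg_le by blast
  ultimately show ?case by (meson finite_imageI finite_subset)
qed

lemma finite_good_trees: "finite {T. tree_good D T \<and> tree_total T = \<gamma>}"
  by (rule finite_subset[OF _ finite_good_trees_deg_le[of "cone_deg \<gamma>"]]) auto

text \<open>For a good tree this is the scalar factor of \<open>G\<close> at its only degree; it
  reduces the analysis to complex-valued functions of \<open>z\<close>.\<close>

definition gval :: "'g dec_tree \<Rightarrow> complex \<Rightarrow> complex" where
  "gval T z = G D T z (tree_total T)"

lemma hprod_gen:
  assumes "\<And>T. T \<in> set ts \<Longrightarrow> f T = (\<lambda>\<eta>. c T * gen (s T) \<eta>)" "\<And>T. T \<in> set ts \<Longrightarrow> s T \<in> pos_cone D"
  shows "hprod D (map f ts) = (\<lambda>\<eta>. (\<Prod>T\<leftarrow>ts. c T) * gen (sum_list (map s ts)) \<eta>)"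
  using assms
proof (induction ts)
  case (Cons T ts)
  have "hprod D (map f (T # ts)) = hmult D (f T) (hprod D (map f ts))"
    by (simp add: hprod_def)
  also have "\<dots> = hmult D (\<lambda>\<eta>. c T * gen (s T) \<eta>) (\<lambda>\<eta>. (\<Prod>T\<leftarrow>ts. c T) * gen (sum_list (map s ts)) \<eta>)"
    using Cons by simp
  also have "\<dots> = (\<lambda>\<eta>. (c T * (\<Prod>T\<leftarrow>ts. c T)) * gen (s T + sum_list (map s ts)) \<eta>)"
    using Cons.prems by (intro hmult_gen_gen sum_list_in_cone) auto
  finally show ?case by simp
qed (simp add: hprod_def)

lemma ray_integral_zero: "ray_integral w (\<lambda>z. 0) = 0"
  by (simp add: ray_integral_def set_lebesgue_integral_def)

text \<open>The assumption on the branches lets this one computation serve both the induction in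
  \<open>G_eq_gval\<close> and the integral recursion \<open>gval_Node\<close>.\<close>

lemma G_Node_if_branches:
  assumes good: "tree_good D (Node g ts)"
    and branch: "\<And>T z. T \<in> set ts \<Longrightarrow> G D T z = (\<lambda>\<eta>. gval T z * gen (tree_total T) \<eta>)"
  shows "G D (Node g ts) z \<eta> = ray_integral (- charge D g)
     (\<lambda>z'. 1 / z' * rho z z' * exp (L D z' g) * (\<Prod>T\<leftarrow>ts. gval T z')) * gen (tree_total (Node g ts)) \<eta>"
proof -
  have "hprod D (map (\<lambda>T. G D T z') ts) = (\<lambda>\<eta>. (\<Prod>T\<leftarrow>ts. gval T z') * gen (sum_list (map tree_total ts)) \<eta>)" for z'
    using good by (intro hprod_gen branch tree_total_in_cone) auto
  then have "hmult D (gen g) (hprod D (map (\<lambda>T. G D T z') ts))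
     = hmult D (\<lambda>\<eta>. 1 * gen g \<eta>) (\<lambda>\<eta>. (\<Prod>T\<leftarrow>ts. gval T z') * gen (sum_list (map tree_total ts)) \<eta>)" for z'
    by simp
  also have "\<dots> z' = (\<lambda>\<eta>. (1 * (\<Prod>T\<leftarrow>ts. gval T z')) * gen (tree_total (Node g ts)) \<eta>)" for z'
    using good unfolding tree_total.simps
    by (intro hmult_gen_gen sum_list_in_cone) (auto intro!: positive[of g] tree_total_in_cone)
  finally show ?thesis
    by (cases "\<eta> = tree_total (Node g ts)") (simp_all add: gen_def ray_integral_zero)
qed

lemma G_eq_gval: "tree_good D T \<Longrightarrow> G D T z = (\<lambda>\<eta>. gval T z * gen (tree_total T) \<eta>)"
proof (induction T arbitrary: z)
  case (Node g ts)
  then have "G D T z = (\<lambda>\<eta>. gval T z * gen (tree_total T) \<eta>)" if "T \<in> set ts" for T z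
    using that by simp
  from G_Node_if_branches[OF Node.prems this] show ?case
    by (simp add: gval_def gen_def fun_eq_iff del: G.simps tree_good.simps tree_total.simps)
qed

lemma gval_Node:
  assumes "tree_good D (Node g ts)"
  shows "gval (Node g ts) z = ray_integral (- charge D g)
     (\<lambda>z'. 1 / z' * rho z z' * exp (L D z' g) * (\<Prod>T\<leftarrow>ts. gval T z'))"
proof -
  have "G D T z = (\<lambda>\<eta>. gval T z * gen (tree_total T) \<eta>)" if "T \<in> set ts" for T z
    using that assms by (intro G_eq_gval) simp
  from G_Node_if_branches[OF assms this, of z "tree_total (Node g ts)"] show ?thesis
    unfolding gval_def[of "Node g ts"]
    by (simp add: gen_def del: G.simps tree_good.simps tree_total.simps)
qed

end


section \<open>Integrals over rays\<close>

lemma set_integrable_exp_minus: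
  assumes "(c :: real) > 0"
  shows "set_integrable lborel {0<..} (\<lambda>t. exp (- c * t))"
proof -
  have "(\<lambda>t. exp (- c * t)) absolutely_integrable_on {0..}"
    by (intro nonnegative_absolutely_integrable_1 integrable_on_exp_minus_to_infinity) (use assms in auto)
  then have "integrable lebesgue (\<lambda>t. indicator {0..} t *\<^sub>R exp (- c * t))"
    by (simp add: set_integrable_def)
  then have "set_integrable lborel {0..} (\<lambda>t. exp (- c * t))"
    unfolding set_integrable_def by (subst (asm) integrable_completion) auto
  then show ?thesis by (rule set_integrable_subset) auto
qed

lemma set_integrable_continuous_bound:
  fixes f :: "real \<Rightarrow> complex" and g :: "real \<Rightarrow> real"
  assumes "continuous_on {0<..} f" "set_integrable lborel {0<..} g"
    and "\<And>t. t > 0 \<Longrightarrow> norm (f t) \<le> g t"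
  shows "set_integrable lborel {0<..} f"
  unfolding set_integrable_def
proof (rule Bochner_Integration.integrable_bound)
  show "integrable lborel (\<lambda>t. indicator {0<..} t *\<^sub>R g t)"
    using assms(2) by (simp add: set_integrable_def)
  show "(\<lambda>t. indicator {0<..} t *\<^sub>R f t) \<in> borel_measurable lborel"
    using borel_measurable_continuous_on_indicator[OF _ assms(1)] by simp
  show "AE t in lborel. norm (indicator {0<..} t *\<^sub>R f t) \<le> norm (indicator {0<..} t *\<^sub>R g t)"
    using order.trans[OF assms(3) abs_ge_self] by (intro AE_I2) (auto simp: indicator_def)
qed

text \<open>The integrals below have the form of an integrable density \<open>\<kappa>\<close> times
  a bounded continuous kernel; this gives their existence and their size.\<close>

lemma set_integral_kernel:
  fixes \<kappa> k :: "real \<Rightarrow> complex"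
  assumes \<kappa>: "set_integrable lborel {0<..} \<kappa>" and k: "continuous_on {0<..} k"
    and B: "\<And>t. t > 0 \<Longrightarrow> norm (k t) \<le> B"
  shows "set_integrable lborel {0<..} (\<lambda>t. \<kappa> t * k t)"
    and "norm (LINT t:{0<..}|lborel. \<kappa> t * k t) \<le> B * (LINT t:{0<..}|lborel. norm (\<kappa> t))"
proof -
  let ?I = "indicator {0<..} :: real \<Rightarrow> real"
  have \<kappa>': "integrable lborel (\<lambda>t. ?I t *\<^sub>R \<kappa> t)" using \<kappa> by (simp add: set_integrable_def)
  have n: "integrable lborel (\<lambda>t. B * norm (?I t *\<^sub>R \<kappa> t))"
    using \<kappa>' by (intro integrable_mult_right integrable_norm)
  have le: "norm (?I t *\<^sub>R (\<kappa> t * k t)) \<le> B * norm (?I t *\<^sub>R \<kappa> t)" for t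
    using B[of t] mult_left_mono[of "norm (k t)" B "norm (\<kappa> t)"]
    by (auto simp: indicator_def norm_mult mult.commute)
  \<comment> \<open>Repeating the indicator exhibits the integrand as a product of two measurable
    functions.\<close>
  have eq: "(\<lambda>t. ?I t *\<^sub>R (\<kappa> t * k t)) = (\<lambda>t. (?I t *\<^sub>R \<kappa> t) * (?I t *\<^sub>R k t))"
    by (auto simp: indicator_def)
  have "integrable lborel (\<lambda>t. ?I t *\<^sub>R (\<kappa> t * k t))"
  proof (rule Bochner_Integration.integrable_bound[OF n])
    show "(\<lambda>t. ?I t *\<^sub>R (\<kappa> t * k t)) \<in> borel_measurable lborel"
      unfolding eq using borel_measurable_continuous_on_indicator[OF _ k] borel_measurable_integrable[OF \<kappa>']
      by (intro borel_measurable_times) auto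
    show "AE t in lborel. norm (?I t *\<^sub>R (\<kappa> t * k t)) \<le> norm (B * norm (?I t *\<^sub>R \<kappa> t))"
      using le by (intro AE_I2) (metis abs_ge_self order.trans real_norm_def)
  qed
  moreover from this have "norm (LINT t|lborel. ?I t *\<^sub>R (\<kappa> t * k t)) \<le> (LINT t|lborel. B * norm (?I t *\<^sub>R \<kappa> t))"
    using n le by (intro Bochner_Integration.integral_norm_bound_integral) auto
  ultimately show "set_integrable lborel {0<..} (\<lambda>t. \<kappa> t * k t)"
    "norm (LINT t:{0<..}|lborel. \<kappa> t * k t) \<le> B * (LINT t:{0<..}|lborel. norm (\<kappa> t))"
    by (simp_all add: set_integrable_def set_lebesgue_integral_def)
qed

text \<open>The closed half-line has open complement, so a ball around \<open>w / \<omega>\<close>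
  avoids it; multiplication by \<open>\<omega>\<close> scales its radius to
  \<open>d\<close>.\<close>

lemma dist_ray:
  assumes "\<omega> \<noteq> 0" "w / \<omega> \<notin> \<real>\<^sub>\<ge>\<^sub>0"
  obtains d where "d > 0" "\<And>t. t \<ge> 0 \<Longrightarrow> d \<le> cmod (of_real t * \<omega> - w)"
proof -
  have "open (- \<real>\<^sub>\<ge>\<^sub>0 :: complex set)" by (simp add: open_Compl)
  with assms obtain e where e: "e > 0" "ball (w / \<omega>) e \<subseteq> - \<real>\<^sub>\<ge>\<^sub>0"
    by (meson ComplI openE)
  have "e * cmod \<omega> \<le> cmod (of_real t * \<omega> - w)" if "t \<ge> 0" for t :: real
  proof -
    have "of_real t \<in> (\<real>\<^sub>\<ge>\<^sub>0 :: complex set)" using that by simp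
    then have "e \<le> dist (w / \<omega>) (of_real t)" using e(2) by (force simp: not_less[symmetric])
    then have "e * cmod \<omega> \<le> cmod (of_real t - w / \<omega>) * cmod \<omega>"
      by (intro mult_right_mono) (auto simp: dist_norm norm_minus_commute)
    also have "\<dots> = cmod (of_real t * \<omega> - w)"
      using assms(1) by (simp add: norm_mult[symmetric] left_diff_distrib)
    finally show ?thesis .
  qed
  then show ?thesis using that[of "e * cmod \<omega>"] e assms by simp
qed

text \<open>The kernel is that of \<open>rho\<close> without its constant factor, along the
  parametrised ray \<open>t \<omega>\<close>; all other factors of the integrand go into
  \<open>\<kappa>\<close>.\<close>

definition ray_transform :: "complex \<Rightarrow> (real \<Rightarrow> complex) \<Rightarrow> complex \<Rightarrow> complex" where
  "ray_transform \<omega> \<kappa> w = (LINT t:{0<..}|lborel. \<kappa> t * ((of_real t * \<omega> + w) / (of_real t * \<omega> - w)))"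

text \<open>Differentiation under the integral by an exact remainder: with \<open>\<rho>'\<close>
  the derivative of the kernel at \<open>w\<close>, the first-order Taylor remainder equals
  \<open>(u - w)\<^sup>2 * R u t\<close>, and \<open>R\<close> is bounded uniformly in
  \<open>t\<close> and in \<open>u\<close> near \<open>w\<close>.\<close>

lemma ray_transform_differentiable:
  assumes \<kappa>: "set_integrable lborel {0<..} \<kappa>" and \<omega>: "\<omega> \<noteq> 0" and w: "w / \<omega> \<notin> \<real>\<^sub>\<ge>\<^sub>0"
  shows "ray_transform \<omega> \<kappa> field_differentiable at w"
proof -
  from dist_ray[OF \<omega> w] obtain d where d: "d > 0" "\<And>t. t \<ge> 0 \<Longrightarrow> d \<le> cmod (of_real t * \<omega> - w)"
    by blast
  define \<rho> where "\<rho> u t = (of_real t * \<omega> + u) / (of_real t * \<omega> - u)" for u and t :: real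
  define \<rho>' where "\<rho>' t = 2 * of_real t * \<omega> / (of_real t * \<omega> - w)\<^sup>2" for t :: real
  define R where "R u t = 2 * of_real t * \<omega> / ((of_real t * \<omega> - u) * (of_real t * \<omega> - w)\<^sup>2)" for u and t :: real
  \<comment> \<open>This bound on \<open>R\<close> combines
    \<open>|t \<omega>| \<le> (1 + |w| / d) |t \<omega> - w|\<close> with the lower bounds
    \<open>d / 2\<close> and \<open>d\<close> for the distances to \<open>u\<close> and
    \<open>w\<close>.\<close>
  let ?M = "2 * (1 + cmod w / d) / (d / 2 * d)"
  have du: "d / 2 \<le> cmod (of_real t * \<omega> - u)" if "cmod (u - w) < d / 2" "t > 0" for u t
  proof -
    have "cmod (of_real t * \<omega> - w) \<le> cmod (of_real t * \<omega> - u) + cmod (u - w)"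
      by (metis diff_add_cancel add_diff_eq norm_triangle_ineq)
    then show ?thesis using d(2)[of t] that by linarith
  qed
  have tw: "cmod (of_real t * \<omega>) \<le> (1 + cmod w / d) * cmod (of_real t * \<omega> - w)" if "t > 0" for t
  proof -
    have "cmod (of_real t * \<omega>) \<le> cmod (of_real t * \<omega> - w) + cmod w"
      by (metis diff_add_cancel norm_triangle_ineq)
    also have "cmod w = cmod w / d * d" using d by simp
    also have "\<dots> \<le> cmod w / d * cmod (of_real t * \<omega> - w)"
      using d that by (intro mult_left_mono) auto
    finally show ?thesis by (simp add: distrib_right)
  qed
  have R_bound: "norm (R u t) \<le> ?M" if u: "cmod (u - w) < d / 2" and t: "t > 0" for u t
  proof -
    have p: "0 < cmod (of_real t * \<omega> - w)" "0 < cmod (of_real t * \<omega> - u)"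
      using d(1) d(2)[of t] du[OF u t] t by linarith+
    have "norm (R u t) = 2 * (cmod (of_real t * \<omega>) / cmod (of_real t * \<omega> - w))
        / (cmod (of_real t * \<omega> - u) * cmod (of_real t * \<omega> - w))"
      using p by (simp add: R_def norm_mult norm_divide norm_power power2_eq_square mult_ac)
    also have "\<dots> \<le> ?M"
      using p d(1) d(2)[of t] du[OF u t] t tw[OF t]
      by (intro frac_le mult_mono mult_left_mono mult_nonneg_nonneg) (auto simp: divide_simps)
    finally show ?thesis .
  qed
  have cont: "continuous_on {0<..} (\<rho> u)" "continuous_on {0<..} (R u)" if u: "cmod (u - w) < d / 2" for u
  proof -
    have "of_real t * \<omega> \<noteq> u" "of_real t * \<omega> \<noteq> w" if "t > 0" for t
      using du[OF u that] d(1) d(2)[of t] that by auto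
    then show "continuous_on {0<..} (\<rho> u)" "continuous_on {0<..} (R u)"
      unfolding \<rho>_def R_def by (auto intro!: continuous_intros)
  qed
  have cont': "continuous_on {0<..} \<rho>'"
  proof -
    have "of_real t * \<omega> \<noteq> w" if "t > 0" for t
      using d(1) d(2)[of t] that by auto
    then show ?thesis unfolding \<rho>'_def by (auto intro!: continuous_intros)
  qed
  have int_\<rho>: "set_integrable lborel {0<..} (\<lambda>t. \<kappa> t * \<rho> u t)" if u: "cmod (u - w) < d / 2" for u
  proof (rule set_integral_kernel(1)[OF \<kappa> cont(1)[OF u]])
    fix t :: real assume t: "t > 0"
    have p: "0 < cmod (of_real t * \<omega> - u)" using du[OF u t] d(1) by linarith
    \<comment> \<open>The numerator is the denominator plus \<open>2 * u\<close>, and the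
      denominator is at least \<open>d / 2\<close>.\<close>
    have "cmod (of_real t * \<omega> + u) \<le> cmod (of_real t * \<omega> - u) + 2 * cmod u"
      using norm_triangle_ineq[of "of_real t * \<omega> - u" "2 * u"] by (simp add: norm_mult add.commute)
    also have "2 * cmod u \<le> 2 * cmod u / (d / 2) * cmod (of_real t * \<omega> - u)"
      using mult_left_mono[OF du[OF u t], of "2 * cmod u"] d(1) by (simp add: field_simps)
    finally have "cmod (of_real t * \<omega> + u) \<le> (1 + 2 * cmod u / (d / 2)) * cmod (of_real t * \<omega> - u)"
      by (simp add: distrib_right)
    then show "norm (\<rho> u t) \<le> 1 + 2 * cmod u / (d / 2)"
      using p by (simp add: \<rho>_def norm_divide pos_divide_le_eq)
  qed
  have int_\<rho>': "set_integrable lborel {0<..} (\<lambda>t. \<kappa> t * \<rho>' t)"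
  proof (rule set_integral_kernel(1)[OF \<kappa> cont'])
    fix t :: real assume t: "t > 0"
    have p: "0 < cmod (of_real t * \<omega> - w)" using d(1) d(2)[of t] t by linarith
    have "norm (\<rho>' t) = 2 * (cmod (of_real t * \<omega>) / cmod (of_real t * \<omega> - w)) / cmod (of_real t * \<omega> - w)"
      using p by (simp add: \<rho>'_def norm_mult norm_divide norm_power power2_eq_square)
    also have "\<dots> \<le> 2 * (1 + cmod w / d) / d"
      using p d(1) d(2)[of t] t tw[OF t]
      by (intro frac_le mult_left_mono mult_nonneg_nonneg) (auto simp: divide_simps)
    finally show "norm (\<rho>' t) \<le> 2 * (1 + cmod w / d) / d" .
  qed
  have int_R: "norm (LINT t:{0<..}|lborel. \<kappa> t * R u t) \<le> ?M * (LINT t:{0<..}|lborel. norm (\<kappa> t))"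
    "set_integrable lborel {0<..} (\<lambda>t. \<kappa> t * R u t)"
    if u: "cmod (u - w) < d / 2" for u
    using set_integral_kernel[OF \<kappa> cont(2)[OF u] R_bound[OF u]] by blast+
  let ?F = "ray_transform \<omega> \<kappa>" and ?F' = "LINT t:{0<..}|lborel. \<kappa> t * \<rho>' t"
    and ?N = "LINT t:{0<..}|lborel. norm (\<kappa> t)"
  have key: "?F u - ?F w - (u - w) * ?F' = (u - w)\<^sup>2 * (LINT t:{0<..}|lborel. \<kappa> t * R u t)"
    if u: "cmod (u - w) < d / 2" for u
  proof -
    have w': "cmod (w - w) < d / 2" using d by simp
    have "?F u - ?F w - (u - w) * ?F'
        = (LINT t:{0<..}|lborel. \<kappa> t * \<rho> u t - \<kappa> t * \<rho> w t - (u - w) * (\<kappa> t * \<rho>' t))"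
      using int_\<rho>[OF u] int_\<rho>[OF w'] int_\<rho>'
      by (simp add: ray_transform_def \<rho>_def[symmetric] set_integral_diff)
    also have "\<dots> = (LINT t:{0<..}|lborel. (u - w)\<^sup>2 * (\<kappa> t * R u t))"
    proof (rule set_lebesgue_integral_cong)
      show "\<forall>t. t \<in> {0<..} \<longrightarrow> \<kappa> t * \<rho> u t - \<kappa> t * \<rho> w t - (u - w) * (\<kappa> t * \<rho>' t) = (u - w)\<^sup>2 * (\<kappa> t * R u t)"
      proof (intro allI impI)
        fix t :: real assume "t \<in> {0<..}"
        then have ne: "of_real t * \<omega> - w \<noteq> 0" "of_real t * \<omega> - u \<noteq> 0"
          using du[OF u, of t] du[OF w', of t] d(1) by auto
        have "(x + u) / (x - u) - (x + w) / (x - w) - (u - w) * (2 * x / (x - w)\<^sup>2)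
           = (u - w)\<^sup>2 * (2 * x / ((x - u) * (x - w)\<^sup>2))" if "x - w \<noteq> 0" "x - u \<noteq> 0" for x
          using that by (simp add: divide_simps) (simp add: power2_eq_square algebra_simps)
        from this[OF ne] show "\<kappa> t * \<rho> u t - \<kappa> t * \<rho> w t - (u - w) * (\<kappa> t * \<rho>' t) = (u - w)\<^sup>2 * (\<kappa> t * R u t)"
          unfolding \<rho>_def \<rho>'_def R_def
          by (metis (no_types, opaque_lifting) mult.assoc mult.left_commute right_diff_distrib)
      qed
    qed simp
    finally show ?thesis by simp
  qed
  have "((\<lambda>u. (?F u - ?F w) / (u - w)) \<longlongrightarrow> ?F') (at w)"
  proof (rule Lim_null[THEN iffD2])
    show "((\<lambda>u. (?F u - ?F w) / (u - w) - ?F') \<longlongrightarrow> 0) (at w)"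
    proof (rule Lim_null_comparison)
      show "\<forall>\<^sub>F u in at w. norm ((?F u - ?F w) / (u - w) - ?F') \<le> cmod (u - w) * (?M * ?N)"
        unfolding eventually_at
      proof (intro exI[of _ "d / 2"] conjI ballI impI)
        fix u assume u: "u \<noteq> w \<and> dist u w < d / 2"
        then have u': "cmod (u - w) < d / 2" by (simp add: dist_norm)
        have "(?F u - ?F w) / (u - w) - ?F' = (?F u - ?F w - (u - w) * ?F') / (u - w)"
          using u by (simp add: field_simps)
        also have "\<dots> = (u - w) * (LINT t:{0<..}|lborel. \<kappa> t * R u t)"
          unfolding key[OF u'] using u by (simp add: power2_eq_square)
        finally have eq: "(?F u - ?F w) / (u - w) - ?F' = (u - w) * (LINT t:{0<..}|lborel. \<kappa> t * R u t)" .
        show "norm ((?F u - ?F w) / (u - w) - ?F') \<le> cmod (u - w) * (?M * ?N)"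
          unfolding eq norm_mult using int_R(1)[OF u'] by (intro mult_left_mono) auto
      qed (use d in auto)
      show "((\<lambda>u. cmod (u - w) * (?M * ?N)) \<longlongrightarrow> 0) (at w)"
        by (rule tendsto_eq_intros | simp)+
    qed
  qed
  then show ?thesis
    unfolding field_differentiable_def has_field_derivative_iff by blast
qed

text \<open>The kernel is invariant under scaling \<open>t\<close> and the argument together: the
  distance of \<open>s u\<close> from the ray is at least \<open>s d\<close>, so the factor
  \<open>s\<close> cancels and the bound is the same for all \<open>s\<close>.\<close>

lemma ray_transform_bounded:
  assumes \<kappa>: "set_integrable lborel {0<..} \<kappa>" and \<omega>: "\<omega> \<noteq> 0" and u: "u / \<omega> \<notin> \<real>\<^sub>\<ge>\<^sub>0"
  shows "\<exists>B. \<forall>s>0. norm (ray_transform \<omega> \<kappa> (of_real s * u)) \<le> B"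
proof -
  from dist_ray[OF \<omega> u] obtain d where d: "d > 0" "\<And>t. t \<ge> 0 \<Longrightarrow> d \<le> cmod (of_real t * \<omega> - u)"
    by blast
  have "norm (ray_transform \<omega> \<kappa> (of_real s * u)) \<le> (1 + 2 * cmod u / d) * (LINT t:{0<..}|lborel. norm (\<kappa> t))"
    if s: "s > 0" for s
    unfolding ray_transform_def
  proof (rule set_integral_kernel(2)[OF \<kappa>])
    have ds: "s * d \<le> cmod (of_real t * \<omega> - of_real s * u)" if t: "t > 0" for t
    proof -
      have "of_real t * \<omega> - of_real s * u = of_real s * (of_real (t / s) * \<omega> - u)"
        using s by (simp add: field_simps)
      then have "cmod (of_real t * \<omega> - of_real s * u) = s * cmod (of_real (t / s) * \<omega> - u)"
        using s by (simp add: norm_mult)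
      then show ?thesis using d(2)[of "t / s"] s t by simp
    qed
    have pos: "0 < s * d" using s d by simp
    show "continuous_on {0<..} (\<lambda>t. (of_real t * \<omega> + of_real s * u) / (of_real t * \<omega> - of_real s * u))"
    proof (intro continuous_intros)
      show "\<forall>t\<in>{0<..}. of_real t * \<omega> - of_real s * u \<noteq> 0"
        using ds pos by (metis greaterThan_iff norm_zero not_le)
    qed
    fix t :: real assume t: "t > 0"
    let ?a = "of_real t * \<omega> - of_real s * u"
    have p: "0 < cmod ?a" using ds[OF t] pos by linarith
    have "cmod (of_real t * \<omega> + of_real s * u) \<le> cmod ?a + 2 * (s * cmod u)"
      using norm_triangle_ineq[of ?a "2 * (of_real s * u)"] s by (simp add: norm_mult add.commute mult.commute)
    also have "2 * (s * cmod u) \<le> 2 * cmod u / d * cmod ?a"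
      using mult_left_mono[OF ds[OF t], of "2 * cmod u"] d(1) by (simp add: field_simps)
    finally have "cmod (of_real t * \<omega> + of_real s * u) \<le> (1 + 2 * cmod u / d) * cmod ?a"
      by (simp add: distrib_right)
    then show "norm ((of_real t * \<omega> + of_real s * u) / ?a) \<le> 1 + 2 * cmod u / d"
      using p by (simp add: norm_divide pos_divide_le_eq)
  qed
  then show ?thesis by blast
qed

context positive_generic_stability
begin

text \<open>A zero charge would force norm zero by the support property.\<close>

lemma charge_nonzero:
  assumes "DT D x \<noteq> 0" "x \<noteq> 0"
  shows "charge D x \<noteq> 0"
proof
  assume "charge D x = 0"
  moreover obtain C where "\<forall>x. DT D x \<noteq> 0 \<longrightarrow>
        norm (\<chi> i. real_of_int (coords D x $ i)) \<le> C * cmod (charge D x)"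
    using support by blast
  ultimately have "norm (\<chi> i. real_of_int (coords D x $ i)) \<le> 0" using assms(1) by fastforce
  then have "coords D x = 0" by (simp add: vec_eq_iff)
  then have "x = lat_point D 0" using lat_point_coords[of x] by simp
  then show False using assms(2) by (simp add: lat_point_def zsmul_def)
qed

text \<open>The half-line removed here is closed, so the origin is excluded too, unlike in
  \<open>ray\<close>.\<close>

definition off_ray :: "'g \<Rightarrow> complex \<Rightarrow> bool" where
  "off_ray \<gamma> w \<longleftrightarrow> w / (- charge D \<gamma>) \<notin> \<real>\<^sub>\<ge>\<^sub>0"

lemma off_rayI:
  assumes "w \<noteq> 0" "w \<notin> ray D \<gamma>" "charge D \<gamma> \<noteq> 0"
  shows "off_ray \<gamma> w"
  unfolding off_ray_def
proof
  assume "w / (- charge D \<gamma>) \<in> \<real>\<^sub>\<ge>\<^sub>0"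
  then obtain t where t: "t \<ge> 0" "w / (- charge D \<gamma>) = of_real t"
    by (auto simp: nonneg_Reals_def)
  then have "w = of_real t * (- charge D \<gamma>)"
    using assms(3) by (metis neg_equal_0_iff_equal nonzero_divide_eq_eq)
  then have "w = - of_real t * charge D \<gamma>" by simp
  moreover from this have "t \<noteq> 0" using assms(1) by auto
  ultimately show False using assms(2) t(1) by (force simp: ray_def)
qed

text \<open>By genericity a nonzero pairing forces distinct rays, and rays from the origin with a
  common point coincide.\<close>

lemma off_ray_of_pairing:
  assumes "DT D x \<noteq> 0" "DT D y \<noteq> 0" "pairing D x y \<noteq> 0" "t > 0"
  shows "off_ray x (of_real t * (- charge D y))"
proof (rule off_rayI)
  have x0: "x \<noteq> 0" using assms(3) pairing_zero_left by auto
  have "y \<noteq> 0" using assms(3) pairing_skew[of x y] pairing_zero_left by auto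
  then have y: "charge D y \<noteq> 0" and x: "charge D x \<noteq> 0"
    using x0 charge_nonzero assms by auto
  show "charge D x \<noteq> 0" by fact
  show "of_real t * (- charge D y) \<noteq> 0" using y assms(4) by simp
  show "of_real t * (- charge D y) \<notin> ray D x"
  proof
    assume "of_real t * (- charge D y) \<in> ray D x"
    then obtain s where s: "s > 0" "of_real t * (- charge D y) = - of_real s * charge D x"
      by (auto simp: ray_def)
    have e: "charge D y = of_real (s / t) * charge D x"
      using s(2) assms(4) by (simp add: field_simps)
    have "ray D y = ray D x"
    proof (intro equalityI subsetI)
      fix v assume "v \<in> ray D y"
      then obtain r where "r > 0" "v = - of_real r * charge D y" by (auto simp: ray_def)
      then have "r * (s / t) > 0 \<and> v = - of_real (r * (s / t)) * charge D x"
        using s(1) assms(4) by (simp add: e)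
      then show "v \<in> ray D x" unfolding ray_def by blast
    next
      fix v assume "v \<in> ray D x"
      then obtain r where "r > 0" "v = - of_real r * charge D x" by (auto simp: ray_def)
      then have "r * (t / s) > 0 \<and> v = - of_real (r * (t / s)) * charge D y"
        using s(1) assms(4) by (simp add: e)
      then show "v \<in> ray D y" unfolding ray_def by blast
    qed
    then show False using generic[OF assms(1,2)] assms(3) by simp
  qed
qed

text \<open>Both parts are needed in the induction: differentiability makes the branch factors
  continuous along the ray of the root, boundedness keeps the density integrable at both ends. The
  two ray transform lemmas then return both parts for the whole tree.\<close>

lemma gval_regular:
  assumes "tree_good D T"
  shows "(\<forall>w. off_ray (root_dec T) w \<longrightarrow> gval T field_differentiable at w) \<and>
     (\<forall>u. off_ray (root_dec T) u \<longrightarrow> (\<exists>B. \<forall>s>0. norm (gval T (of_real s * u)) \<le> B))"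
  using assms
proof (induction T)
  case (Node g ts)
  define \<omega> where "\<omega> = - charge D g"
  have g: "DT D g \<noteq> 0" "g \<noteq> 0" using Node.prems by auto
  then have \<omega>: "\<omega> \<noteq> 0" using charge_nonzero by (simp add: \<omega>_def)
  define P where "P t = (\<Prod>T\<leftarrow>ts. gval T (of_real t * \<omega>))" for t :: real
  \<comment> \<open>The integrand without the kernel: on the ray, \<open>dz' / z'\<close> becomes
    \<open>dt / t\<close>, and the last divisor is the constant of \<open>rho\<close>.\<close>
  define \<kappa> where "\<kappa> t = exp (L D (of_real t * \<omega>) g) * P t / of_real t / (4 * of_real pi * \<i>)" for t :: real
  have off: "off_ray (root_dec T) (of_real t * \<omega>)" if "T \<in> set ts" "t > 0" for T t
  proof -
    have "DT D (root_dec T) \<noteq> 0" using Node.prems that by (cases T) auto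
    then show ?thesis unfolding \<omega>_def using Node.prems that by (intro off_ray_of_pairing) auto
  qed
  have good: "tree_good D T" if "T \<in> set ts" for T using Node.prems that by auto
  have P: "continuous_on {0<..} P \<and> (\<exists>B. \<forall>t>0. norm (P t) \<le> B)"
  proof -
    have "continuous_on {0<..} (\<lambda>t. \<Prod>T\<leftarrow>us. gval T (of_real t * \<omega>))
        \<and> (\<exists>B. \<forall>t>0. norm (\<Prod>T\<leftarrow>us. gval T (of_real t * \<omega>)) \<le> B)" if "set us \<subseteq> set ts" for us
      using that
    proof (induction us)
      case Nil
      show ?case by (auto intro: exI[of _ 1])
    next
      case (Cons T us)
      then have T: "T \<in> set ts" by simp
      note reg = Node.IH[OF T good[OF T]]
      have "continuous_on {0<..} (\<lambda>t. gval T (of_real t * \<omega>))"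
      proof (rule continuous_on_compose2[where g = "gval T" and t = "(\<lambda>t. of_real t * \<omega>) ` {0<..}"])
        show "continuous_on ((\<lambda>t. of_real t * \<omega>) ` {0<..}) (gval T)"
          using reg off[OF T] field_differentiable_imp_continuous_at
          by (intro continuous_at_imp_continuous_on) blast
      qed (auto intro!: continuous_intros)
      moreover obtain B where B: "\<And>s. s > 0 \<Longrightarrow> norm (gval T (of_real s * \<omega>)) \<le> B"
        using reg off[OF T, of 1] by (metis mult_1 of_real_1 zero_less_one)
      moreover obtain B' where B': "\<And>t. t > 0 \<Longrightarrow> norm (\<Prod>T\<leftarrow>us. gval T (of_real t * \<omega>)) \<le> B'"
        using Cons by auto
      have "norm (\<Prod>T\<leftarrow>T # us. gval T (of_real t * \<omega>)) \<le> B * B'" if "t > 0" for t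
        using mult_mono'[OF B[OF that] B'[OF that]] by (simp add: norm_mult)
      ultimately show ?case using Cons by (auto intro!: continuous_on_mult)
    qed
    from this[of ts] show ?thesis unfolding P_def by simp
  qed
  then obtain B where B: "\<And>t. t > 0 \<Longrightarrow> norm (P t) \<le> B" by blast
  \<comment> \<open>On its own ray the exponent is real, and its exponential decays both at the
    origin and at infinity.\<close>
  have L: "L D (of_real t * \<omega>) g = of_real (- (1 / t) - (cmod \<omega>)\<^sup>2 * t)" if "t > 0" for t
  proof -
    have "L D (of_real t * \<omega>) g = of_real (- (1 / t)) - of_real t * (charge D g * cnj (charge D g))"
      using \<omega> that by (simp add: L_def \<omega>_def field_simps)
    then show ?thesis
      by (simp add: complex_norm_square[symmetric] \<omega>_def mult.commute)
  qed
  have \<kappa>_int: "set_integrable lborel {0<..} \<kappa>"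
  proof (rule set_integrable_continuous_bound)
    show "set_integrable lborel {0<..} (\<lambda>t. B / (4 * pi) * exp (- (cmod \<omega>)\<^sup>2 * t))"
      using set_integrable_exp_minus[of "(cmod \<omega>)\<^sup>2"] \<omega> by (simp del: mult_minus_left)
    show "continuous_on {0<..} \<kappa>"
      unfolding \<kappa>_def L_def using P \<omega> by (auto intro!: continuous_intros)
    fix t :: real assume t: "t > 0"
    \<comment> \<open>The decay at the origin absorbs the singularity \<open>1 / t\<close>; the
      other exponential remains as an integrable majorant.\<close>
    have "1 / t * exp (- (1 / t)) \<le> 1"
    proof -
      have "1 / t \<le> exp (1 / t)" using exp_ge_add_one_self[of "1 / t"] by linarith
      then have "1 / t * exp (- (1 / t)) \<le> exp (1 / t) * exp (- (1 / t))"
        by (rule mult_right_mono) simp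
      then show ?thesis by (simp flip: exp_add)
    qed
    then have "(1 / t * exp (- (1 / t))) * (exp (- (cmod \<omega>)\<^sup>2 * t) * norm (P t))
       \<le> 1 * (exp (- (cmod \<omega>)\<^sup>2 * t) * B)"
      using B[OF t] t by (intro mult_mono mult_left_mono) auto
    moreover have "exp (- (1 / t) - (cmod \<omega>)\<^sup>2 * t) = exp (- (1 / t)) * exp (- (cmod \<omega>)\<^sup>2 * t)"
      by (simp add: exp_add[symmetric])
    ultimately have "1 / t * (exp (- (1 / t) - (cmod \<omega>)\<^sup>2 * t) * norm (P t)) \<le> exp (- (cmod \<omega>)\<^sup>2 * t) * B"
      by (simp add: mult_ac)
    then have "1 / t * (exp (- (1 / t) - (cmod \<omega>)\<^sup>2 * t) * norm (P t)) / (4 * pi)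
        \<le> exp (- (cmod \<omega>)\<^sup>2 * t) * B / (4 * pi)"
      by (rule divide_right_mono) simp
    then show "norm (\<kappa> t) \<le> B / (4 * pi) * exp (- (cmod \<omega>)\<^sup>2 * t)"
      unfolding \<kappa>_def L[OF t] using t
      by (simp add: norm_mult norm_divide norm_exp_eq_Re mult_ac)
  qed
  have eq: "gval (Node g ts) = ray_transform \<omega> \<kappa>"
  proof
    fix w
    have "1 / (x * \<omega>) * (1 / c * r) * e * p * \<omega> = e * p / x / c * r" for x c r e p :: complex
      using \<omega> by simp
    then show "gval (Node g ts) w = ray_transform \<omega> \<kappa> w"
      unfolding gval_Node[OF Node.prems] ray_integral_def ray_transform_def \<omega>_def[symmetric]
      by (simp only: \<kappa>_def P_def rho_def)
  qed
  show ?case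
    unfolding eq off_ray_def dec_tree.sel \<omega>_def[symmetric]
    using ray_transform_differentiable[OF \<kappa>_int \<omega>] ray_transform_bounded[OF \<kappa>_int \<omega>] by blast
qed

lemma gval_differentiable:
  assumes "tree_good D T" "z \<noteq> 0" "\<And>\<gamma>. DT D \<gamma> \<noteq> 0 \<Longrightarrow> z \<notin> ray D \<gamma>"
  shows "gval T field_differentiable at z"
proof -
  have "DT D (root_dec T) \<noteq> 0" "root_dec T \<noteq> 0" using assms(1) by (cases T; simp)+
  then have "off_ray (root_dec T) z" using assms(2,3) charge_nonzero by (intro off_rayI) auto
  then show ?thesis using gval_regular[OF assms(1)] by blast
qed

end


section \<open>The automorphism \<open>X\<close> and its derivative\<close>

context positive_generic_stability
begin

text \<open>Trees that are not good have weight zero, and finitely many good trees have a given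
  total. The index set is independent of \<open>z\<close>, so the sum can be differentiated term by
  term.\<close>

lemma pair_trees_finite_sum:
  assumes "\<And>T. tree_good D T \<Longrightarrow> tree_total T \<noteq> \<gamma> \<Longrightarrow> F T \<gamma> = 0"
  shows "pair_trees D \<alpha> F \<gamma> = (\<Sum>T | T \<in> tree_reps \<and> tree_good D T \<and> tree_total T = \<gamma>.
           of_rat (pairing_rat D (rat_coords D \<alpha>) (W D T)) * F T \<gamma>)"
proof -
  let ?S = "{T. T \<in> tree_reps \<and> tree_good D T \<and> tree_total T = \<gamma>}"
  have "finite ?S" by (rule finite_subset[OF _ finite_good_trees[of \<gamma>]]) auto
  moreover have "pair_trees D \<alpha> F \<gamma>
      = (\<Sum>\<^sub>\<infinity>T\<in>?S. of_rat (pairing_rat D (rat_coords D \<alpha>) (W D T)) * F T \<gamma>)"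
    unfolding pair_trees_def
  proof (rule infsum_cong_neutral)
    fix T :: "'g dec_tree" assume "T \<in> tree_reps - ?S"
    then have "W D T = 0 \<or> F T \<gamma> = 0" using assms tree_good_if_weight by blast
    then show "of_rat (pairing_rat D (rat_coords D \<alpha>) (W D T)) * F T \<gamma> = 0"
      by (auto simp: pairing_rat_zero_right)
  qed auto
  ultimately show ?thesis by simp
qed

lemma G_support: "tree_good D T \<Longrightarrow> tree_total T \<noteq> \<gamma> \<Longrightarrow> G D T z \<gamma> = 0"
  by (simp add: G_eq_gval gen_def)

lemma dz_G_support: "tree_good D T \<Longrightarrow> tree_total T \<noteq> \<gamma> \<Longrightarrow> dz (G D T) z \<gamma> = 0"
  by (simp add: dz_def G_support)

lemma L_coords: "L D z \<alpha> = (\<Sum>j\<in>UNIV. of_int (coords D \<alpha> $ j) * L D z (basis D j))"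
  using additive_coords[of "L D z" \<alpha>] by (simp add: L_def charge_add algebra_simps)

text \<open>\<open>L\<close> and the pairing are linear in \<open>\<alpha>\<close>. Hence the
  exponent at \<open>\<alpha>\<close> becomes \<open>\<alpha> \<cdot> \<Phi>\<close> in formal
  variables, and \<open>X\<close> becomes a substitution.\<close>

lemma X_exponent_coords:
  "X_exponent D z \<alpha> \<gamma> = (\<Sum>j\<in>UNIV. of_int (coords D \<alpha> $ j) * X_exponent D z (basis D j) \<gamma>)"
proof -
  let ?S = "{T. T \<in> tree_reps \<and> tree_good D T \<and> tree_total T = \<gamma>}"
  have pt: "pair_trees D x (\<lambda>T. G D T z) \<gamma> = (\<Sum>T\<in>?S. of_rat (pairing_rat D (rat_coords D x) (W D T)) * G D T z \<gamma>)" for x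
    by (rule pair_trees_finite_sum) (rule G_support)
  have "pair_trees D \<alpha> (\<lambda>T. G D T z) \<gamma>
      = (\<Sum>T\<in>?S. \<Sum>j\<in>UNIV. of_int (coords D \<alpha> $ j) *
          (of_rat (pairing_rat D (rat_coords D (basis D j)) (W D T)) * G D T z \<gamma>))"
    unfolding pt
    by (subst pairing_rat_coords) (simp add: of_rat_sum of_rat_mult sum_distrib_right mult.assoc)
  also have "\<dots> = (\<Sum>j\<in>UNIV. of_int (coords D \<alpha> $ j) * pair_trees D (basis D j) (\<lambda>T. G D T z) \<gamma>)"
    unfolding pt by (subst sum.swap) (simp add: sum_distrib_left)
  finally show ?thesis
    unfolding X_exponent_def
    by (subst L_coords) (simp add: sum_distrib_right right_diff_distrib sum_subtractf mult.assoc)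
qed

lemma to_mfps_X_exponent: "to_mfps D (X_exponent D z (cone_point D a)) = vscale a (Phi D z)"
proof (rule mfps_eqI)
  fix n
  have "mfps_nth (to_mfps D (X_exponent D z (cone_point D a))) n
      = (\<Sum>j\<in>UNIV. of_nat (a $ j) * X_exponent D z (basis D j) (cone_point D n))"
    unfolding mfps_nth_to_mfps by (subst X_exponent_coords) (simp add: coords_cone_point)
  then show "mfps_nth (to_mfps D (X_exponent D z (cone_point D a))) n = mfps_nth (vscale a (Phi D z)) n"
    by (simp add: vscale_def Phi_def mfps_nth_to_mfps)
qed

lemma X_gen:
  assumes "\<alpha> \<in> pos_cone D"
  shows "X D z (gen \<alpha>) = hmult D (gen \<alpha>) (hexp D (X_exponent D z \<alpha>))"
proof
  fix \<gamma>
  have "X D z (gen \<alpha>) \<gamma> = (\<Sum>\<^sub>\<infinity>\<beta>\<in>{\<alpha>}. gen \<alpha> \<beta> * hmult D (gen \<beta>) (hexp D (X_exponent D z \<beta>)) \<gamma>)"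
    unfolding X_def lin_ext_def
    by (rule infsum_cong_neutral) (use assms in \<open>auto simp: gen_def\<close>)
  then show "X D z (gen \<alpha>) \<gamma> = hmult D (gen \<alpha>) (hexp D (X_exponent D z \<alpha>)) \<gamma>"
    by (simp add: gen_def)
qed

lemma to_mfps_X_gen: "to_mfps D (X D z (gen (cone_point D a))) = lagrange_basis (Phi D z) a"
  by (simp add: X_gen to_mfps_hmult to_mfps_gen to_mfps_hexp to_mfps_X_exponent lagrange_basis_def)

lemma X_in_ghat: "X D z f \<in> ghat D"
  by (simp add: ghat_def X_def lin_ext_def hmult_outside)

text \<open>The image of a monomial only involves larger exponents, so each coefficient of the
  infinite sum defining \<open>X\<close> is finite.\<close>

lemma to_mfps_X:
  "to_mfps D (X D z f) = Abs_mfps (\<lambda>n. \<Sum>a | \<forall>i. a $ i \<le> n $ i.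
      f (cone_point D a) * mfps_nth (lagrange_basis (Phi D z) a) n)"
proof (rule mfps_eqI)
  fix n :: "nat ^ 'm"
  let ?A = "{a. \<forall>i. a $ i \<le> n $ i}"
  have b: "hmult D (gen (cone_point D a)) (hexp D (X_exponent D z (cone_point D a))) (cone_point D n)
      = mfps_nth (lagrange_basis (Phi D z) a) n" for a
    using to_mfps_X_gen[of z a] by (simp add: X_gen mfps_nth_to_mfps[symmetric])
  have "X D z f (cone_point D n) = (\<Sum>\<^sub>\<infinity>\<alpha>\<in>cone_point D ` ?A.
      f \<alpha> * hmult D (gen \<alpha>) (hexp D (X_exponent D z \<alpha>)) (cone_point D n))"
    unfolding X_def lin_ext_def
  proof (rule infsum_cong_neutral)
    fix \<alpha> assume "\<alpha> \<in> pos_cone D - cone_point D ` ?A"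
    then obtain a where "\<alpha> = cone_point D a" "a \<notin> ?A" unfolding pos_cone_eq by blast
    then show "f \<alpha> * hmult D (gen \<alpha>) (hexp D (X_exponent D z \<alpha>)) (cone_point D n) = 0"
      using lagrange_basis_eq_0[of a n] by (simp add: b)
  qed auto
  also have "\<dots> = (\<Sum>a\<in>?A. f (cone_point D a) * mfps_nth (lagrange_basis (Phi D z) a) n)"
    by (simp add: finite_vec_nat_le sum.reindex inj_on_def b)
  finally show "mfps_nth (to_mfps D (X D z f)) n = mfps_nth (Abs_mfps (\<lambda>n. \<Sum>a | \<forall>i. a $ i \<le> n $ i.
      f (cone_point D a) * mfps_nth (lagrange_basis (Phi D z) a) n)) n"
    by (simp add: mfps_nth_to_mfps)
qed

text \<open>The coefficients of \<open>f\<close> are recovered as the Lagrange coefficients of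
  \<open>X f\<close>. This makes \<open>inv_into\<close> a genuine left inverse on
  \<open>ghat D\<close>.\<close>

lemma inj_X: "inj_on (X D z) (ghat D)"
proof (rule inj_onI)
  fix f g assume fg: "f \<in> ghat D" "g \<in> ghat D" "X D z f = X D z g"
  have h: "h (cone_point D b) = lagrange_coeff (Phi D z) (to_mfps D (X D z h)) b" for h b
    by (simp only: to_mfps_X lagrange_coeff_series)
  have "f (cone_point D b) = g (cone_point D b)" for b
    by (rule trans[OF h[of f b, unfolded fg(3)] h[of g b, symmetric]])
  then show "f = g"
    using fg by (intro ghat_eqI mfps_eqI) (auto simp: mfps_nth_to_mfps)
qed

text \<open>The Lagrange expansion of the variable \<open>s_i\<close> exhibits it as the image under
  \<open>X\<close> of the series with these coefficients.\<close>

lemma inv_X_gen: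
  "inv_into (ghat D) (X D z) (gen (basis D i)) =
    (\<lambda>\<gamma>. if \<gamma> \<in> pos_cone D then lagrange_coeff (Phi D z) (mfps_var i) (exponent D \<gamma>) else 0)"
    (is "_ = ?f")
proof (rule inv_into_f_eq[OF inj_X])
  show "?f \<in> ghat D" by (simp add: ghat_def)
  show "X D z ?f = gen (basis D i)"
  proof (rule ghat_eqI[OF X_in_ghat gen_in_ghat[OF basis_in_cone]])
    have "to_mfps D (gen (basis D i)) = mfps_var i"
      using to_mfps_gen[of "axis i 1"] unfolding cone_point_axis mfps_var_def mfps_monom_def .
    then show "to_mfps D (X D z ?f) = to_mfps D (gen (basis D i))"
      by (intro mfps_eqI) (simp add: to_mfps_X lagrange_expansion[of "mfps_var i" _ "Phi D z"])
  qed
qed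

text \<open>The \<open>z\<close>-derivative of the exponent of \<open>X(e_\<alpha>)\<close>, at
  points off the rays.\<close>

definition X_log_deriv :: "complex \<Rightarrow> 'g \<Rightarrow> 'g \<Rightarrow> complex" where
  "X_log_deriv z \<alpha> = (\<lambda>\<eta>. deriv (\<lambda>w. L D w \<alpha>) z * gen 0 \<eta> - pair_trees D \<alpha> (\<lambda>T. dz (G D T) z) \<eta>)"

lemma X_exponent_has_field_derivative:
  assumes z: "z \<noteq> 0" "\<And>\<gamma>. DT D \<gamma> \<noteq> 0 \<Longrightarrow> z \<notin> ray D \<gamma>"
  shows "((\<lambda>w. X_exponent D w \<alpha> \<eta>) has_field_derivative X_log_deriv z \<alpha> \<eta>) (at z)"
proof -
  let ?S = "{T. T \<in> tree_reps \<and> tree_good D T \<and> tree_total T = \<eta>}"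
  have "((\<lambda>w. L D w \<alpha>) has_field_derivative - charge D \<alpha> / z ^ 2 + cnj (charge D \<alpha>)) (at z)"
    unfolding L_def using z(1) by (auto intro!: derivative_eq_intros simp: power2_eq_square field_simps)
  then have dL: "((\<lambda>w. L D w \<alpha>) has_field_derivative deriv (\<lambda>w. L D w \<alpha>) z) (at z)"
    by (simp add: DERIV_imp_deriv)
  have dG: "((\<lambda>w. G D T w \<eta>) has_field_derivative dz (G D T) z \<eta>) (at z)" if "tree_good D T" for T
  proof -
    have "(\<lambda>w. gval T w * gen (tree_total T) \<eta>) field_differentiable at z"
      using gval_differentiable[OF that z] by (intro field_differentiable_mult) auto
    then show ?thesis
      by (simp add: dz_def G_eq_gval[OF that] field_differentiable_derivI)
  qed
  have "((\<lambda>w. \<Sum>T\<in>?S. of_rat (pairing_rat D (rat_coords D \<alpha>) (W D T)) * G D T w \<eta>) has_field_derivative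
         (\<Sum>T\<in>?S. of_rat (pairing_rat D (rat_coords D \<alpha>) (W D T)) * dz (G D T) z \<eta>)) (at z)"
    using dG by (intro DERIV_sum DERIV_cmult) auto
  then have dP: "((\<lambda>w. pair_trees D \<alpha> (\<lambda>T. G D T w) \<eta>) has_field_derivative
      pair_trees D \<alpha> (\<lambda>T. dz (G D T) z) \<eta>) (at z)"
    by (subst (1 2) pair_trees_finite_sum) (simp_all add: G_support dz_G_support)
  show ?thesis
    unfolding X_exponent_def X_log_deriv_def
    by (intro DERIV_diff DERIV_cmult_right dL dP)
qed

text \<open>Each coefficient of \<open>X(e_\<alpha>)\<close> is a finite convolution of the constant
  series of \<open>e_\<alpha>\<close> with the exponential, to which the chain rule applies.\<close>

lemma dz_X_gen:
  assumes z: "z \<noteq> 0" "\<And>\<gamma>. DT D \<gamma> \<noteq> 0 \<Longrightarrow> z \<notin> ray D \<gamma>" and \<alpha>: "\<alpha> \<in> pos_cone D"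
  shows "dz (\<lambda>w. X D w (gen \<alpha>)) z = hmult D (X D z (gen \<alpha>)) (X_log_deriv z \<alpha>)"
proof
  fix \<gamma>
  show "dz (\<lambda>w. X D w (gen \<alpha>)) z \<gamma> = hmult D (X D z (gen \<alpha>)) (X_log_deriv z \<alpha>) \<gamma>"
  proof (cases "\<gamma> \<in> pos_cone D")
    case False
    then show ?thesis using X_in_ghat by (simp add: dz_def hmult_outside ghat_def)
  next
    case True
    then obtain n where n: "\<gamma> = cone_point D n" by (auto simp: pos_cone_eq)
    let ?M = "to_mfps D (gen \<alpha>)" and ?E = "\<lambda>w. mfps_exp (to_mfps D (X_exponent D w \<alpha>))"
      and ?Y = "to_mfps D (X_log_deriv z \<alpha>)"
    have X: "X D w (gen \<alpha>) \<gamma> = (\<Sum>(p, q)\<in>{(p, q). p + q = n}. mfps_nth ?M p * mfps_nth (?E w) q)" for w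
      unfolding n mfps_nth_to_mfps[symmetric] X_gen[OF \<alpha>] to_mfps_hmult to_mfps_hexp
      by (rule mfps_nth_times)
    have "((\<lambda>w. mfps_nth (?E w) q) has_field_derivative mfps_nth (?E z * ?Y) q) (at z)" for q
      by (rule mfps_exp_has_field_derivative)
         (simp add: mfps_nth_to_mfps X_exponent_has_field_derivative[OF z])
    then have "((\<lambda>w. X D w (gen \<alpha>) \<gamma>) has_field_derivative
        (\<Sum>(p, q)\<in>{(p, q). p + q = n}. mfps_nth ?M p * mfps_nth (?E z * ?Y) q)) (at z)"
      unfolding X split_def by (intro DERIV_sum DERIV_cmult)
    then have "dz (\<lambda>w. X D w (gen \<alpha>)) z \<gamma> = mfps_nth (?M * (?E z * ?Y)) n"
      unfolding dz_def mfps_nth_times[of ?M] by (rule DERIV_imp_deriv)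
    also have "\<dots> = hmult D (X D z (gen \<alpha>)) (X_log_deriv z \<alpha>) \<gamma>"
      unfolding n mfps_nth_to_mfps[symmetric] X_gen[OF \<alpha>] to_mfps_hmult to_mfps_hexp
      by (simp only: mult.assoc)
    finally show ?thesis .
  qed
qed

lemma conn_A_gen:
  assumes z: "z \<noteq> 0" "\<And>\<gamma>. DT D \<gamma> \<noteq> 0 \<Longrightarrow> z \<notin> ray D \<gamma>"
  shows "conn_A D z (gen (basis D i)) = (\<lambda>\<gamma>. - (\<Sum>\<^sub>\<infinity>\<alpha>\<in>pos_cone D - {0}.
     lagrange_coeff (Phi D z) (mfps_var i) (exponent D \<alpha>)
       * hmult D (X D z (gen \<alpha>)) (X_log_deriv z \<alpha>) \<gamma>))"
proof
  fix \<gamma>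
  \<comment> \<open>The variable has no constant term, so \<open>\<alpha> = 0\<close> contributes
    nothing and the sum runs over the nonzero elements of the cone.\<close>
  have "mfps_nth (mfps_var i) 0 = 0"
    by (simp add: mfps_var_def vec_eq_iff axis_def)
  then have 0: "lagrange_coeff (Phi D z) (mfps_var i) (exponent D 0) = 0"
    using exponent_eq_0_iff[OF cone_zero] by (simp add: lagrange_coeff_def)
  have "dX D z (inv_into (ghat D) (X D z) (gen (basis D i))) \<gamma> = (\<Sum>\<^sub>\<infinity>\<alpha>\<in>pos_cone D - {0}.
     lagrange_coeff (Phi D z) (mfps_var i) (exponent D \<alpha>) * hmult D (X D z (gen \<alpha>)) (X_log_deriv z \<alpha>) \<gamma>)"
    unfolding dX_def lin_ext_def inv_X_gen
    by (rule infsum_cong_neutral) (auto simp: dz_X_gen[OF z] 0)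
  then show "conn_A D z (gen (basis D i)) \<gamma> = - (\<Sum>\<^sub>\<infinity>\<alpha>\<in>pos_cone D - {0}.
     lagrange_coeff (Phi D z) (mfps_var i) (exponent D \<alpha>) * hmult D (X D z (gen \<alpha>)) (X_log_deriv z \<alpha>) \<gamma>)"
    by (simp add: conn_A_def)
qed

end

theorem proposition3p15:
  fixes D :: "('g::ab_group_add, 'm::finite) stab" and z :: complex and i :: 'm
  assumes "positive_generic_stability D"
    and "z \<noteq> 0"
    and "\<And>\<gamma>. DT D \<gamma> \<noteq> 0 \<Longrightarrow> z \<notin> ray D \<gamma>"
  shows "conn_A D z (gen (basis D i)) =
    (\<lambda>\<gamma>. - (\<Sum>\<^sub>\<infinity>\<alpha>\<in>pos_cone D - {0}.
       mfps_nth
         (det (\<chi> p q. (if p = q then 1 else 0) + mfps_var p * mfps_pderiv q (Phi D z p))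
            * mfps_var i * mfps_exp (- (\<Sum>j\<in>UNIV. of_int (coords D \<alpha> $ j) * Phi D z j)))
         (exponent D \<alpha>)
       * hmult D (X D z (gen \<alpha>))
           (\<lambda>\<eta>. deriv (\<lambda>w. L D w \<alpha>) z * gen 0 \<eta> - pair_trees D \<alpha> (\<lambda>T. dz (G D T) z) \<eta>) \<gamma>))"
proof -
  interpret positive_generic_stability D by fact
  \<comment> \<open>On the cone the integer coordinates are natural numbers, so the integral
    combination in the statement is \<open>vscale\<close>.\<close>
  have vscale: "(\<Sum>j\<in>UNIV. of_int (coords D \<alpha> $ j) * Phi D z j) = vscale (exponent D \<alpha>) (Phi D z)"
    if "\<alpha> \<in> pos_cone D" for \<alpha>
    using that by (auto simp: pos_cone_eq coords_cone_point vscale_def)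
  show ?thesis
    unfolding lagrange_jac_eq X_log_deriv_def[symmetric]
    by (subst conn_A_gen[OF assms(2,3)], assumption)
       (intro ext arg_cong[where f = uminus] infsum_cong, simp add: lagrange_coeff_def vscale)
qed

end
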